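(* Let $p\ge 5$ be a prime, $n\ge 1$ an integer, and let $\Gamma=\Gamma_1(p^n)$ or $\Gamma=\Gamma_0(p^n)$. Then the image of $\tilde\xi_\Gamma:\mathbf Z[\Gamma\backslash\mathrm{PSL}_2(\mathbf Z)]\to\tilde{\mathcal M}_\Gamma$ has finite index dividing $3$ in $\tilde{\mathcal M}_\Gamma$. The index equals $1$ (i.e. the divisibility is strict) if and only if $p\equiv 1\pmod 3$ and $\Gamma=\Gamma_0(p^n)$.
   Context: Let $\Gamma$ be a finite index subgroup of $\mathrm{SL}_2(\mathbf Z)$, $T=\begin{pmatrix}1&1\\0&1\end{pmatrix}$, $S=\begin{pmatrix}0&-1\\1&0\end{pmatrix}$. Mixed modular symbols: $\tilde{\mathcal M}$ is the torsion-free abelian group generated by symbols $\{g,g'\}$, $(g,g')\in\mathrm{SL}_2(\mathbf Z)^2$, subject to: (1) $\{g,g'\}+\{g',g''\}+\{g'',g\}=0$; (2) $\{g,g'\}=\{\epsilon_1 g,\epsilon_2 g'\}$ for $\epsilon_1,\epsilon_2\in\{1,-1\}$; (3) $\{g,gT^m\}=m\cdot\{g,gT\}$ for $m\in\mathbf Z$. (That is, the quotient of the free abelian group by these relations, modulo torsion.) $\mathrm{SL}_2(\mathbf Z)$ acts on the left by $g\cdot\{g',g''\}=\{gg',gg''\}$, and $\tilde{\mathcal M}_\Gamma$ is the largest torsion-free quotient of $\tilde{\mathcal M}$ on which $\Gamma$ acts trivially. The Manin map $\tilde\xi_\Gamma:\mathbf Z[\Gamma\backslash\mathrm{PSL}_2(\mathbf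 Z)]\to\tilde{\mathcal M}_\Gamma$ is the group homomorphism given by $\tilde\xi_\Gamma(\Gamma g)=\{g,gS\}$. *)

theory Defs
  imports
    "HOL-Analysis.Determinants"
    "HOL-Algebra.Free_Abelian_Groups"
    "HOL-Algebra.Generated_Groups"
    "HOL-Number_Theory.Cong"
    "HOL-Computational_Algebra.Primes"
begin

section \<open>The modular group and its congruence subgroups\<close>

definition SL2Z :: "(int^2^2) monoid" where
  "SL2Z = \<lparr>carrier = {A. det A = 1}, mult = (**), one = mat 1\<rparr>"

definition matT :: "int^2^2" where
  "matT = vector [vector [1, 1], vector [0, 1]]"

definition matS :: "int^2^2" where
  "matS = vector [vector [0, -1], vector [1, 0]]"

definition Gamma0 :: "nat \<Rightarrow> (int^2^2) set" where
  "Gamma0 N = {A \<in> carrier SL2Z. [A$2$1 = 0] (mod int N)}"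

definition Gamma1 :: "nat \<Rightarrow> (int^2^2) set" where
  "Gamma1 N = {A \<in> carrier SL2Z.
     [A$1$1 = 1] (mod int N) \<and> [A$2$1 = 0] (mod int N) \<and> [A$2$2 = 1] (mod int N)}"

definition PSL2Z :: "(int^2^2) set monoid" where
  "PSL2Z = SL2Z Mod {mat 1, - mat 1}"

definition to_PSL2Z :: "int^2^2 \<Rightarrow> (int^2^2) set" where
  "to_PSL2Z g = {mat 1, - mat 1} #>\<^bsub>SL2Z\<^esub> g"

text \<open>\<open>PSL2Z_cosets \<Gamma>\<close> is the set of cosets \<open>\<Gamma> g\<close> in PSL2(Z), where \<open>\<Gamma>\<close> is replaced by its
  image in PSL2(Z), as it need not contain \<open>- mat 1\<close>.  HOL-Algebra's \<open>rcosets\<close> are the sets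
  \<open>H g\<close>.\<close>

definition PSL2Z_coset :: "(int^2^2) set \<Rightarrow> int^2^2 \<Rightarrow> (int^2^2) set set" where
  "PSL2Z_coset \<Gamma> g = (to_PSL2Z ` \<Gamma>) #>\<^bsub>PSL2Z\<^esub> to_PSL2Z g"

definition PSL2Z_cosets :: "(int^2^2) set \<Rightarrow> (int^2^2) set set set" where
  "PSL2Z_cosets \<Gamma> = rcosets\<^bsub>PSL2Z\<^esub> (to_PSL2Z ` \<Gamma>)"


section \<open>Torsion\<close>

text \<open>Abelian groups are written multiplicatively, as everywhere in HOL-Algebra.\<close>

definition torsion_subgroup :: "('a, 'b) monoid_scheme \<Rightarrow> 'a set" where
  "torsion_subgroup G = {x \<in> carrier G. \<exists>n::nat. n > 0 \<and> x [^]\<^bsub>G\<^esub> n = \<one>\<^bsub>G\<^esub>}"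

definition torsion_free :: "('a, 'b) monoid_scheme \<Rightarrow> bool" where
  "torsion_free G \<longleftrightarrow> torsion_subgroup G = {\<one>\<^bsub>G\<^esub>}"


section \<open>Mixed modular symbols\<close>

type_synonym formal_symbols = "(int^2^2) \<times> (int^2^2) \<Rightarrow>\<^sub>0 int"

abbreviation symbol_pairs :: "((int^2^2) \<times> (int^2^2)) set" where
  "symbol_pairs \<equiv> carrier SL2Z \<times> carrier SL2Z"

definition symbol_relations :: "formal_symbols set" where
  "symbol_relations =
     {frag_of (g, g') + frag_of (g', g'') + frag_of (g'', g) | g g' g''.
        g \<in> carrier SL2Z \<and> g' \<in> carrier SL2Z \<and> g'' \<in> carrier SL2Z} \<union>
     {frag_of (g, g') - frag_of (e1 ** g, e2 ** g') | g g' e1 e2.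
        g \<in> carrier SL2Z \<and> g' \<in> carrier SL2Z \<and>
        e1 \<in> {mat 1, - mat 1} \<and> e2 \<in> {mat 1, - mat 1}} \<union>
     {frag_of (g, g ** (matT [^]\<^bsub>SL2Z\<^esub> m)) - frag_cmul m (frag_of (g, g ** matT)) | g (m :: int).
        g \<in> carrier SL2Z}"

definition symbol_relation_subgroup :: "formal_symbols set" where
  "symbol_relation_subgroup = generate (free_Abelian_group symbol_pairs) symbol_relations"

definition presented_symbols :: "formal_symbols set monoid" where
  "presented_symbols = free_Abelian_group symbol_pairs Mod symbol_relation_subgroup"

definition mixed_symbols :: "formal_symbols set set monoid" where
  "mixed_symbols = presented_symbols Mod torsion_subgroup presented_symbols"

definition mixed_symbol :: "int^2^2 \<Rightarrow> int^2^2 \<Rightarrow> formal_symbols set set" where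
  "mixed_symbol g g' =
     torsion_subgroup presented_symbols #>\<^bsub>presented_symbols\<^esub>
       (symbol_relation_subgroup #>\<^bsub>free_Abelian_group symbol_pairs\<^esub> frag_of (g, g'))"

text \<open>An element of \<open>mixed_symbols\<close> is a coset of cosets of formal sums, so the action induced by
  \<open>free_symbol_action \<gamma>\<close> on this iterated quotient is an iterated image.\<close>

definition free_symbol_action ::
    "int^2^2 \<Rightarrow> formal_symbols \<Rightarrow> formal_symbols" where
  "free_symbol_action \<gamma> = frag_extend (\<lambda>(g', g''). frag_of (\<gamma> ** g', \<gamma> ** g''))"

definition mixed_symbol_action ::
    "int^2^2 \<Rightarrow> formal_symbols set set \<Rightarrow>
       formal_symbols set set" where
  "mixed_symbol_action \<gamma> X = ((`) (free_symbol_action \<gamma>)) ` X"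

text \<open>The largest torsion-free quotient with trivial \<open>\<Gamma>\<close>-action is the quotient by the smallest
  subgroup whose quotient has these two properties.\<close>

definition coinvariant_subgroups ::
    "(int^2^2) set \<Rightarrow> formal_symbols set set set set" where
  "coinvariant_subgroups \<Gamma> =
     {N. subgroup N mixed_symbols \<and> torsion_free (mixed_symbols Mod N) \<and>
         (\<forall>\<gamma>\<in>\<Gamma>. \<forall>x\<in>carrier mixed_symbols.
            N #>\<^bsub>mixed_symbols\<^esub> mixed_symbol_action \<gamma> x = N #>\<^bsub>mixed_symbols\<^esub> x)}"

definition coinvariant_kernel ::
    "(int^2^2) set \<Rightarrow> formal_symbols set set set" where
  "coinvariant_kernel \<Gamma> = \<Inter> (coinvariant_subgroups \<Gamma>)"

definition mixed_symbols_mod ::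
    "(int^2^2) set \<Rightarrow> formal_symbols set set set monoid" where
  "mixed_symbols_mod \<Gamma> = mixed_symbols Mod coinvariant_kernel \<Gamma>"

definition mixed_symbol_mod ::
    "(int^2^2) set \<Rightarrow> int^2^2 \<Rightarrow> int^2^2 \<Rightarrow> formal_symbols set set set" where
  "mixed_symbol_mod \<Gamma> g g' = coinvariant_kernel \<Gamma> #>\<^bsub>mixed_symbols\<^esub> mixed_symbol g g'"


section \<open>The Manin map\<close>

text \<open>The choice of a representative is immaterial: see \<open>manin_symbol_coset\<close>,
  \<open>manin_map_coset\<close> and \<open>manin_map_hom\<close> below.\<close>

definition manin_symbol ::
    "(int^2^2) set \<Rightarrow> (int^2^2) set set \<Rightarrow> formal_symbols set set set" where
  "manin_symbol \<Gamma> c =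
     (let g = (SOME g. g \<in> carrier SL2Z \<and> PSL2Z_coset \<Gamma> g = c)
      in mixed_symbol_mod \<Gamma> g (g ** matS))"

definition manin_map ::
    "(int^2^2) set \<Rightarrow> ((int^2^2) set set \<Rightarrow>\<^sub>0 int) \<Rightarrow>
       formal_symbols set set set" where
  "manin_map \<Gamma> x =
     finprod (mixed_symbols_mod \<Gamma>)
       (\<lambda>c. manin_symbol \<Gamma> c [^]\<^bsub>mixed_symbols_mod \<Gamma>\<^esub> Poly_Mapping.lookup x c)
       (Poly_Mapping.keys x)"

definition manin_image ::
    "(int^2^2) set \<Rightarrow> formal_symbols set set set set" where
  "manin_image \<Gamma> = manin_map \<Gamma> ` carrier (free_Abelian_group (PSL2Z_cosets \<Gamma>))"


section \<open>Well-definedness of the constructions\<close>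

lemma group_SL2Z: "group SL2Z"
proof (rule groupI)
  fix A assume "A \<in> carrier SL2Z"
  then have d: "A$1$1 * A$2$2 - A$1$2 * A$2$1 = 1"
    by (simp add: SL2Z_def det_2)
  let ?B = "vector [vector [A$2$2, - A$1$2], vector [- A$2$1, A$1$1]] :: int^2^2"
  have "?B ** A = mat 1"
    using d by (simp add: vec_eq_iff matrix_matrix_mult_def mat_def sum_2 forall_2 algebra_simps)
  moreover have "?B \<in> carrier SL2Z"
    using d by (simp add: SL2Z_def det_2 algebra_simps)
  ultimately show "\<exists>B\<in>carrier SL2Z. B \<otimes>\<^bsub>SL2Z\<^esub> A = \<one>\<^bsub>SL2Z\<^esub>"
    by (auto simp: SL2Z_def)
qed (auto simp: SL2Z_def det_mul matrix_mul_assoc)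

lemma matT_in: "matT \<in> carrier SL2Z"
  by (simp add: SL2Z_def matT_def det_2)

lemma matS_in: "matS \<in> carrier SL2Z"
  by (simp add: SL2Z_def matS_def det_2)

lemma mult_SL2Z: "A \<otimes>\<^bsub>SL2Z\<^esub> B = A ** B"
  by (simp add: SL2Z_def)

lemma mult_in_SL2Z: "A \<in> carrier SL2Z \<Longrightarrow> B \<in> carrier SL2Z \<Longrightarrow> A ** B \<in> carrier SL2Z"
  by (simp add: SL2Z_def det_mul)

lemma inv_SL2Z_eq:
  assumes "A \<in> carrier SL2Z"
  shows "inv\<^bsub>SL2Z\<^esub> A = vector [vector [A$2$2, - A$1$2], vector [- A$2$1, A$1$1]]" (is "_ = ?B")
proof (rule group.inv_equality[OF group_SL2Z])
  have d: "A$1$1 * A$2$2 - A$1$2 * A$2$1 = 1"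
    using assms by (simp add: SL2Z_def det_2)
  show "?B \<otimes>\<^bsub>SL2Z\<^esub> A = \<one>\<^bsub>SL2Z\<^esub>"
    using d by (simp add: SL2Z_def vec_eq_iff matrix_matrix_mult_def mat_def sum_2 forall_2 algebra_simps)
  show "?B \<in> carrier SL2Z"
    using d by (simp add: SL2Z_def det_2 algebra_simps)
qed (rule assms)

lemma minus_one_mult: "(- mat 1) ** A = - (A :: int^2^2)" "A ** (- mat 1) = - (A :: int^2^2)"
  by (simp_all add: vec_eq_iff matrix_matrix_mult_def mat_def sum_2 forall_2)

lemma minus_in_SL2Z: "A \<in> carrier SL2Z \<Longrightarrow> - A \<in> carrier SL2Z"
  by (simp add: SL2Z_def det_2)

lemma subgroup_Gamma0: "subgroup (Gamma0 N) SL2Z"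
proof -
  interpret S: group SL2Z by (rule group_SL2Z)
  show ?thesis
  proof (rule S.subgroupI)
    show "Gamma0 N \<noteq> {}"
      by (auto simp: Gamma0_def SL2Z_def det_2 mat_def intro!: exI[of _ "mat 1"])
    fix A assume A: "A \<in> Gamma0 N"
    then show "inv\<^bsub>SL2Z\<^esub> A \<in> Gamma0 N"
      using S.inv_closed[of A] by (auto simp: Gamma0_def inv_SL2Z_eq cong_0_iff)
    fix B assume "B \<in> Gamma0 N"
    with A show "A \<otimes>\<^bsub>SL2Z\<^esub> B \<in> Gamma0 N"
      using mult_in_SL2Z[of A B]
      by (simp add: Gamma0_def mult_SL2Z matrix_matrix_mult_def sum_2 cong_0_iff)
  qed (auto simp: Gamma0_def)
qed

lemma subgroup_Gamma1: "subgroup (Gamma1 N) SL2Z"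
proof -
  interpret S: group SL2Z by (rule group_SL2Z)
  show ?thesis
  proof (rule S.subgroupI)
    show "Gamma1 N \<noteq> {}"
      by (auto simp: Gamma1_def SL2Z_def det_2 mat_def intro!: exI[of _ "mat 1"])
    fix A assume A: "A \<in> Gamma1 N"
    then show "inv\<^bsub>SL2Z\<^esub> A \<in> Gamma1 N"
      using S.inv_closed[of A] by (auto simp: Gamma1_def inv_SL2Z_eq cong_0_iff)
    fix B assume B: "B \<in> Gamma1 N"
    have c: "[A$1$1 * B$1$1 + A$1$2 * B$2$1 = 1 * 1 + A$1$2 * 0] (mod int N)"
            "[A$2$1 * B$1$1 + A$2$2 * B$2$1 = 0 * B$1$1 + A$2$2 * 0] (mod int N)"
            "[A$2$1 * B$1$2 + A$2$2 * B$2$2 = 0 * B$1$2 + 1 * 1] (mod int N)"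
      using A B by (intro cong_add cong_mult cong_refl; simp add: Gamma1_def)+
    then show "A \<otimes>\<^bsub>SL2Z\<^esub> B \<in> Gamma1 N"
      using A B mult_in_SL2Z[of A B]
      by (simp add: Gamma1_def mult_SL2Z matrix_matrix_mult_def sum_2)
  qed (auto simp: Gamma1_def)
qed

lemma pm_normal: "{mat 1, - mat 1} \<lhd> SL2Z"
proof -
  interpret group SL2Z by (rule group_SL2Z)
  have one: "mat 1 = \<one>\<^bsub>SL2Z\<^esub>" by (simp add: SL2Z_def)
  have mm: "- mat 1 \<in> carrier SL2Z" 
    by (rule minus_in_SL2Z) (simp add: one)
  have sq: "(- mat 1) \<otimes>\<^bsub>SL2Z\<^esub> (- mat 1) = \<one>\<^bsub>SL2Z\<^esub>"
    by (simp add: mult_SL2Z minus_one_mult one[symmetric])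
  have inv: "inv\<^bsub>SL2Z\<^esub> (- mat 1) = - mat 1"
    using sq mm by (simp add: inv_equality)
  have "subgroup {mat 1, - mat 1} SL2Z"
  proof (rule subgroupI)
    show "{mat 1, - mat 1} \<subseteq> carrier SL2Z" using mm by (auto simp: one)
    show "inv\<^bsub>SL2Z\<^esub> a \<in> {mat 1, - mat 1}" if "a \<in> {mat 1, - mat 1}" for a
      using that inv by (auto simp: one)
    show "a \<otimes>\<^bsub>SL2Z\<^esub> b \<in> {mat 1, - mat 1}" if "a \<in> {mat 1, - mat 1}" "b \<in> {mat 1, - mat 1}" for a b
      using that by (auto simp: mult_SL2Z minus_one_mult)
  qed auto
  moreover have "x \<otimes>\<^bsub>SL2Z\<^esub> h \<otimes>\<^bsub>SL2Z\<^esub> inv\<^bsub>SL2Z\<^esub> x \<in> {mat 1, - mat 1}"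
    if x: "x \<in> carrier SL2Z" and h: "h \<in> {mat 1, - mat 1}" for x h
  proof -
    have "x \<otimes>\<^bsub>SL2Z\<^esub> h = h \<otimes>\<^bsub>SL2Z\<^esub> x"
      using h by (auto simp: mult_SL2Z minus_one_mult)
    then have "x \<otimes>\<^bsub>SL2Z\<^esub> h \<otimes>\<^bsub>SL2Z\<^esub> inv\<^bsub>SL2Z\<^esub> x = h"
      using x h mm one by (metis insertE inv_closed m_assoc one_closed r_inv r_one singletonD)
    then show ?thesis using h by simp
  qed
  ultimately show ?thesis by (simp add: normal_inv_iff)
qed

lemma (in comm_group) subgroup_torsion: "subgroup (torsion_subgroup G) G"
proof (rule subgroupI)
  show "torsion_subgroup G \<noteq> {}"
    unfolding torsion_subgroup_def by (auto intro!: exI[of _ "\<one>"] exI[of _ "1::nat"])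
  fix a assume "a \<in> torsion_subgroup G"
  then obtain n :: nat where a: "a \<in> carrier G" "n > 0" "a [^] n = \<one>"
    by (auto simp: torsion_subgroup_def)
  then show "inv a \<in> torsion_subgroup G"
    by (auto simp: torsion_subgroup_def nat_pow_inv intro!: exI[of _ n])
  fix b assume "b \<in> torsion_subgroup G"
  then obtain m :: nat where b: "b \<in> carrier G" "m > 0" "b [^] m = \<one>"
    by (auto simp: torsion_subgroup_def)
  have "a [^] (n * m) = \<one>" "b [^] (n * m) = \<one>"
    using a b by (metis nat_pow_pow nat_pow_one, metis nat_pow_pow nat_pow_one mult.commute)
  then have "(a \<otimes> b) [^] (n * m) = \<one>"
    using a b by (simp add: pow_mult_distrib m_comm)
  then show "a \<otimes> b \<in> torsion_subgroup G"
    using a b by (auto simp: torsion_subgroup_def intro!: exI[of _ "n * m"])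
qed (auto simp: torsion_subgroup_def)

lemma (in comm_group) torsion_free_Mod_iff:
  assumes N: "subgroup N G"
  shows "torsion_free (G Mod N) \<longleftrightarrow>
    (\<forall>x\<in>carrier G. \<forall>n::nat. n > 0 \<longrightarrow> x [^] n \<in> N \<longrightarrow> x \<in> N)"
proof -
  have nN: "N \<lhd> G" using N by (simp add: normal_iff_subgroup)
  interpret Q: comm_group "G Mod N" by (rule abelian_FactGroup[OF N])
  have iff: "N #> x = N \<longleftrightarrow> x \<in> N" if "x \<in> carrier G" for x
    using that N by (metis coset_join1 coset_join2 subgroup.subset rcos_self r_coset_def)
  show ?thesis
  proof
    assume tf: "torsion_free (G Mod N)"
    show "\<forall>x\<in>carrier G. \<forall>n::nat. n > 0 \<longrightarrow> x [^] n \<in> N \<longrightarrow> x \<in> N"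
    proof (intro ballI allI impI)
      fix x and n :: nat assume x: "x \<in> carrier G" "n > 0" "x [^] n \<in> N"
      have "(N #> x) [^]\<^bsub>G Mod N\<^esub> n = N"
        using normal.FactGroup_pow[OF nN x(1), of n] x iff by simp
      then have "N #> x \<in> torsion_subgroup (G Mod N)"
        using x by (auto simp: torsion_subgroup_def carrier_FactGroup)
      with tf have "N #> x = N" by (auto simp: torsion_free_def)
      then show "x \<in> N" using iff x by simp
    qed
  next
    assume r: "\<forall>x\<in>carrier G. \<forall>n::nat. n > 0 \<longrightarrow> x [^] n \<in> N \<longrightarrow> x \<in> N"
    have "X = N" if "X \<in> torsion_subgroup (G Mod N)" for X
    proof -
      from that obtain x n where x: "x \<in> carrier G" "X = N #> x" "(n::nat) > 0"
        "X [^]\<^bsub>G Mod N\<^esub> n = N"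
        by (auto simp: torsion_subgroup_def carrier_FactGroup)
      then have "N #> (x [^] n) = N" using normal.FactGroup_pow[OF nN x(1), of n] by simp
      then have "x [^] n \<in> N" using iff x by simp
      then show ?thesis using r x iff by blast
    qed
    moreover have "N \<in> torsion_subgroup (G Mod N)"
      using Q.subgroup_torsion subgroup.one_closed by force
    ultimately show "torsion_free (G Mod N)" by (auto simp: torsion_free_def)
  qed
qed

lemma (in comm_group) torsion_free_Mod_torsion: "torsion_free (G Mod torsion_subgroup G)"
proof (subst torsion_free_Mod_iff[OF subgroup_torsion], intro ballI allI impI)
  fix x and n :: nat assume x: "x \<in> carrier G" "n > 0" "x [^] n \<in> torsion_subgroup G"
  then obtain m :: nat where "m > 0" "(x [^] n) [^] m = \<one>" by (auto simp: torsion_subgroup_def)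
  then show "x \<in> torsion_subgroup G"
    using x by (auto simp: torsion_subgroup_def nat_pow_pow intro!: exI[of _ "n * m"])
qed

lemma (in group) hom_image_coset:
  assumes "f \<in> hom G G" "N \<subseteq> carrier G" "f ` N = N" "x \<in> carrier G"
  shows "f ` (N #> x) = N #> f x"
proof -
  have "f (h \<otimes> x) = f h \<otimes> f x" if "h \<in> N" for h
    using assms that by (auto simp: hom_mult)
  then have "f ` (N #> x) = (\<Union>h\<in>N. {f h \<otimes> f x})"
    by (auto simp: r_coset_def image_iff)
  also have "\<dots> = (\<Union>h\<in>f ` N. {h \<otimes> f x})" by auto
  finally show ?thesis using assms by (simp add: r_coset_def)
qed

lemma (in comm_group) iso_image_Mod:
  assumes f: "f \<in> iso G G" and N: "subgroup N G" and fN: "f ` N = N"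
  shows "(`) f \<in> iso (G Mod N) (G Mod N)"
proof -
  have nN: "N \<lhd> G" using N by (simp add: normal_iff_subgroup)
  have h: "f \<in> hom G G" and b: "bij_betw f (carrier G) (carrier G)"
    using f by (auto simp: iso_def)
  have sub: "N \<subseteq> carrier G" using N subgroup.subset by blast
  note im = hom_image_coset[OF h sub fN]
  have fc: "f x \<in> carrier G" if "x \<in> carrier G" for x using h that by (auto simp: hom_def)
  have "(`) f \<in> hom (G Mod N) (G Mod N)"
  proof (rule homI)
    fix X Y assume X: "X \<in> carrier (G Mod N)" and Y: "Y \<in> carrier (G Mod N)"
    from X Y obtain x y where xy: "x \<in> carrier G" "X = N #> x" "y \<in> carrier G" "Y = N #> y"
      by (auto simp: carrier_FactGroup)
    show "f ` X \<in> carrier (G Mod N)" using xy im fc by (auto simp: carrier_FactGroup)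
    show "f ` (X \<otimes>\<^bsub>G Mod N\<^esub> Y) = f ` X \<otimes>\<^bsub>G Mod N\<^esub> f ` Y"
      using xy im fc h by (simp add: normal.rcos_sum[OF nN] hom_mult)
  qed
  moreover have "bij_betw ((`) f) (carrier (G Mod N)) (carrier (G Mod N))"
  proof (rule bij_betwI')
    fix X Y assume X: "X \<in> carrier (G Mod N)" and Y: "Y \<in> carrier (G Mod N)"
    then have "X \<subseteq> carrier G" "Y \<subseteq> carrier G"
      using sub by (auto simp: carrier_FactGroup dest: r_coset_subset_G)
    then show "(f ` X = f ` Y) = (X = Y)"
      using b by (auto simp: bij_betw_def dest: inj_on_image_eq_iff)
  next
    fix X assume X: "X \<in> carrier (G Mod N)"
    then show "f ` X \<in> carrier (G Mod N)" using im fc by (auto simp: carrier_FactGroup)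
  next
    fix Y assume Y: "Y \<in> carrier (G Mod N)"
    then obtain y where y: "y \<in> carrier G" "Y = N #> y" by (auto simp: carrier_FactGroup)
    then obtain x where "x \<in> carrier G" "y = f x" using b by (auto simp: bij_betw_def)
    then show "\<exists>X\<in>carrier (G Mod N). Y = f ` X"
      using y im by (auto simp: carrier_FactGroup)
  qed
  ultimately show ?thesis by (simp add: iso_def)
qed

lemma (in comm_group) iso_image_torsion:
  assumes f: "f \<in> iso G G"
  shows "f ` torsion_subgroup G = torsion_subgroup G"
proof -
  have h: "f \<in> hom G G" and b: "bij_betw f (carrier G) (carrier G)"
    using f by (auto simp: iso_def)
  interpret group_hom G G f
    using h by (simp add: group_hom_def group_hom_axioms_def is_group)
  have inj: "inj_on f (carrier G)" using b by (simp add: bij_betw_def)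
  have "f x \<in> torsion_subgroup G \<longleftrightarrow> x \<in> torsion_subgroup G" if x: "x \<in> carrier G" for x
  proof -
    have "f x [^] (n::nat) = \<one> \<longleftrightarrow> x [^] n = \<one>" for n
      using x inj by (metis hom_nat_pow hom_one inj_onD nat_pow_closed one_closed)
    then show ?thesis using x by (auto simp: torsion_subgroup_def)
  qed
  then show ?thesis
    using b by (auto simp: bij_betw_def torsion_subgroup_def image_iff) 
       (metis (no_types, lifting) imageE)+
qed

lemma symbol_relations_in: "symbol_relations \<subseteq> carrier (free_Abelian_group symbol_pairs)"
proof -
  interpret G: group SL2Z by (rule group_SL2Z)
  note mult = mult_in_SL2Z
  have neg: "(mat 1 :: int^2^2) ** a = a" "(- mat 1 :: int^2^2) ** a = - a" for a :: "int^2^2"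
    by (simp_all add: minus_one_mult)
  have add: "Poly_Mapping.keys a \<subseteq> S \<Longrightarrow> Poly_Mapping.keys b \<subseteq> S \<Longrightarrow> Poly_Mapping.keys (a + b) \<subseteq> S" for a b :: formal_symbols and S
    by (rule order_trans[OF keys_add Un_least])
  have diff: "Poly_Mapping.keys a \<subseteq> S \<Longrightarrow> Poly_Mapping.keys b \<subseteq> S \<Longrightarrow> Poly_Mapping.keys (a - b) \<subseteq> S" for a b :: formal_symbols and S
    by (rule order_trans[OF keys_diff Un_least])
  have cm: "Poly_Mapping.keys a \<subseteq> S \<Longrightarrow> Poly_Mapping.keys (frag_cmul k a) \<subseteq> S" for a :: formal_symbols and S k
    by (rule order_trans[OF keys_cmul])
  have "Poly_Mapping.keys r \<subseteq> symbol_pairs" if r: "r \<in> symbol_relations" for r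
  proof -
  consider (1) a b c where "r = frag_of (a, b) + frag_of (b, c) + frag_of (c, a)"
      "a \<in> carrier SL2Z" "b \<in> carrier SL2Z" "c \<in> carrier SL2Z"
    | (2) a b e1 e2 where "r = frag_of (a, b) - frag_of (e1 ** a, e2 ** b)"
      "a \<in> carrier SL2Z" "b \<in> carrier SL2Z" "e1 \<in> {mat 1, - mat 1}" "e2 \<in> {mat 1, - mat 1}"
    | (3) a and m :: int where
      "r = frag_of (a, a ** (matT [^]\<^bsub>SL2Z\<^esub> m)) - frag_cmul m (frag_of (a, a ** matT))"
      "a \<in> carrier SL2Z"
    using r unfolding symbol_relations_def by blast
  then show ?thesis
  proof cases
    case 1
    show ?thesis unfolding 1(1) by (intro add) (use 1 in simp_all)
  next
    case 2
    have "e1 ** a \<in> carrier SL2Z" "e2 ** b \<in> carrier SL2Z"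
      using 2 by (auto simp: neg intro: minus_in_SL2Z)
    then show ?thesis unfolding 2(1) by (intro diff) (use 2 in simp_all)
  next
    case 3
    show ?thesis unfolding 3(1) by (intro diff cm) (use 3 mult matT_in G.int_pow_closed in simp_all)
  qed
  qed
  then show ?thesis by auto
qed

lemma symbol_relation_subgroup: "subgroup symbol_relation_subgroup (free_Abelian_group symbol_pairs)"
  unfolding symbol_relation_subgroup_def
  by (rule group.generate_is_subgroup[OF group_free_Abelian_group symbol_relations_in])

lemma comm_group_presented_symbols: "comm_group presented_symbols"
  unfolding presented_symbols_def
  by (rule comm_group.abelian_FactGroup[OF abelian_free_Abelian_group symbol_relation_subgroup])

lemma comm_group_mixed_symbols: "comm_group mixed_symbols"
  unfolding mixed_symbols_def
  by (intro comm_group.abelian_FactGroup comm_group.subgroup_torsion comm_group_presented_symbols)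

lemma torsion_free_mixed_symbols: "torsion_free mixed_symbols"
  unfolding mixed_symbols_def
  by (intro comm_group.torsion_free_Mod_torsion comm_group_presented_symbols)

lemma free_symbol_action_hom:
  assumes "\<gamma> \<in> carrier SL2Z"
  shows "free_symbol_action \<gamma> \<in> hom (free_Abelian_group symbol_pairs) (free_Abelian_group symbol_pairs)"
proof (rule homI)
  fix x y :: formal_symbols
  show "free_symbol_action \<gamma> (x \<otimes>\<^bsub>free_Abelian_group symbol_pairs\<^esub> y)
     = free_symbol_action \<gamma> x \<otimes>\<^bsub>free_Abelian_group symbol_pairs\<^esub> free_symbol_action \<gamma> y"
    by (simp add: free_symbol_action_def frag_extend_add)
  note mult = mult_in_SL2Z
  assume "x \<in> carrier (free_Abelian_group symbol_pairs)"
  then have "Poly_Mapping.keys x \<subseteq> symbol_pairs" by simp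
  then have "(\<Union>z\<in>Poly_Mapping.keys x. Poly_Mapping.keys (case z of (g', g'') \<Rightarrow> frag_of (\<gamma> ** g', \<gamma> ** g''))) \<subseteq> symbol_pairs"
    using assms mult by (auto simp: keys_frag_of split: prod.splits)
  then show "free_symbol_action \<gamma> x \<in> carrier (free_Abelian_group symbol_pairs)"
    using keys_frag_extend[of "\<lambda>(g', g''). frag_of (\<gamma> ** g', \<gamma> ** g'')" x]
    by (simp add: free_symbol_action_def)
qed

lemma free_symbol_action_comp:
  "free_symbol_action \<gamma> (free_symbol_action \<delta> x) = free_symbol_action (\<gamma> ** \<delta>) x"
proof (rule frag_induction[OF subset_UNIV, where P = "\<lambda>x. free_symbol_action \<gamma> (free_symbol_action \<delta> x) = free_symbol_action (\<gamma> ** \<delta>) x"], goal_cases)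
  case (3 a b)
  then show ?case by (simp add: free_symbol_action_def frag_extend_diff)
qed (auto simp: free_symbol_action_def matrix_mul_assoc split: prod.splits)

lemma free_symbol_action_one: "free_symbol_action (mat 1) x = x"
proof (rule frag_induction[OF subset_UNIV, where P = "\<lambda>x. free_symbol_action (mat 1) x = x"], goal_cases)
  case (3 a b)
  then show ?case by (simp add: free_symbol_action_def frag_extend_diff)
qed (auto simp: free_symbol_action_def split: prod.splits)

lemma inv_SL2Z:
  assumes "\<gamma> \<in> carrier SL2Z"
  obtains \<delta> where "\<delta> \<in> carrier SL2Z" "\<gamma> ** \<delta> = mat 1" "\<delta> ** \<gamma> = mat 1"
proof
  interpret G: group SL2Z by (rule group_SL2Z)
  have one: "mat 1 = \<one>\<^bsub>SL2Z\<^esub>" by (simp add: SL2Z_def)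
  show "inv\<^bsub>SL2Z\<^esub> \<gamma> \<in> carrier SL2Z" using assms by simp
  show "\<gamma> ** inv\<^bsub>SL2Z\<^esub> \<gamma> = mat 1" "inv\<^bsub>SL2Z\<^esub> \<gamma> ** \<gamma> = mat 1"
    using assms by (simp_all only: mult_SL2Z[symmetric] one G.r_inv G.l_inv)
qed

lemma free_symbol_action_relation:
  assumes g: "\<gamma> \<in> carrier SL2Z" and r: "r \<in> symbol_relations"
  shows "free_symbol_action \<gamma> r \<in> symbol_relations"
proof -
  note mult = mult_in_SL2Z
  have com: "\<gamma> ** (e ** h) = e ** (\<gamma> ** h)" if "e \<in> {mat 1, - mat 1}" for e h :: "int^2^2"
  proof -
    have "\<gamma> ** (- h) = - (\<gamma> ** h)"
      by (simp add: vec_eq_iff matrix_matrix_mult_def sum_2)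
    then show ?thesis using that by (auto simp: minus_one_mult)
  qed
  consider (1) a b c where "r = frag_of (a, b) + frag_of (b, c) + frag_of (c, a)"
      "a \<in> carrier SL2Z" "b \<in> carrier SL2Z" "c \<in> carrier SL2Z"
    | (2) a b e1 e2 where "r = frag_of (a, b) - frag_of (e1 ** a, e2 ** b)"
      "a \<in> carrier SL2Z" "b \<in> carrier SL2Z" "e1 \<in> {mat 1, - mat 1}" "e2 \<in> {mat 1, - mat 1}"
    | (3) a and m :: int where
      "r = frag_of (a, a ** (matT [^]\<^bsub>SL2Z\<^esub> m)) - frag_cmul m (frag_of (a, a ** matT))"
      "a \<in> carrier SL2Z"
    using r unfolding symbol_relations_def by blast
  then show ?thesis
  proof cases
    case 1
    then show ?thesis
      unfolding symbol_relations_def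
      by (intro UnI1 CollectI exI[of _ "\<gamma> ** a"] exI[of _ "\<gamma> ** b"] exI[of _ "\<gamma> ** c"])
         (simp add: free_symbol_action_def frag_extend_add mult g)
  next
    case 2
    then show ?thesis
      unfolding symbol_relations_def
      by (intro UnI1[OF UnI2] CollectI exI[of _ "\<gamma> ** a"] exI[of _ "\<gamma> ** b"] exI[of _ e1] exI[of _ e2])
         (simp add: free_symbol_action_def frag_extend_diff mult g com)
  next
    case 3
    then show ?thesis
      unfolding symbol_relations_def
      by (intro UnI2 CollectI exI[of _ "\<gamma> ** a"] exI[of _ m])
         (simp add: free_symbol_action_def frag_extend_diff frag_extend_cmul mult g matrix_mul_assoc)
  qed
qed

lemma free_symbol_action_subgroup:
  assumes g: "\<gamma> \<in> carrier SL2Z"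
  shows "free_symbol_action \<gamma> ` symbol_relation_subgroup = symbol_relation_subgroup"
proof -
  have sub: "free_symbol_action \<gamma> ` symbol_relation_subgroup \<subseteq> symbol_relation_subgroup"
    if g: "\<gamma> \<in> carrier SL2Z" for \<gamma>
  proof -
    let ?F = "free_Abelian_group symbol_pairs"
    interpret group_hom ?F ?F "free_symbol_action \<gamma>"
      by (simp add: group_hom_def group_hom_axioms_def free_symbol_action_hom[OF g])
    have "free_symbol_action \<gamma> ` symbol_relation_subgroup
       = generate ?F (free_symbol_action \<gamma> ` symbol_relations)"
      unfolding symbol_relation_subgroup_def
      by (rule generate_img[symmetric, OF symbol_relations_in])
    also have "\<dots> \<subseteq> symbol_relation_subgroup"
      unfolding symbol_relation_subgroup_def
      using free_symbol_action_relation[OF g] by (intro group.mono_generate group_free_Abelian_group) auto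
    finally show ?thesis .
  qed
  obtain \<delta> where d: "\<delta> \<in> carrier SL2Z" "\<gamma> ** \<delta> = mat 1" using inv_SL2Z[OF g] by metis
  have "x \<in> free_symbol_action \<gamma> ` symbol_relation_subgroup" if "x \<in> symbol_relation_subgroup" for x
    using that sub[OF d(1)] d(2)
    by (intro image_eqI[of _ _ "free_symbol_action \<delta> x"])
       (auto simp: free_symbol_action_comp free_symbol_action_one)
  then show ?thesis using sub[OF g] by auto
qed

lemma free_symbol_action_iso:
  assumes g: "\<gamma> \<in> carrier SL2Z"
  shows "free_symbol_action \<gamma> \<in> iso (free_Abelian_group symbol_pairs) (free_Abelian_group symbol_pairs)"
proof -
  obtain \<delta> where d: "\<delta> \<in> carrier SL2Z" "\<gamma> ** \<delta> = mat 1" "\<delta> ** \<gamma> = mat 1" using inv_SL2Z[OF g] by metis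
  have "bij_betw (free_symbol_action \<gamma>) (carrier (free_Abelian_group symbol_pairs))
     (carrier (free_Abelian_group symbol_pairs))"
    using free_symbol_action_hom[OF g] free_symbol_action_hom[OF d(1)] d(2,3)
    by (intro bij_betw_byWitness[where f' = "free_symbol_action \<delta>"])
       (auto simp: hom_def free_symbol_action_comp free_symbol_action_one)
  then show ?thesis using free_symbol_action_hom[OF g] by (simp add: iso_def)
qed

lemma mixed_symbol_action_iso:
  assumes g: "\<gamma> \<in> carrier SL2Z"
  shows "mixed_symbol_action \<gamma> \<in> iso mixed_symbols mixed_symbols"
proof -
  have 1: "(`) (free_symbol_action \<gamma>) \<in> iso presented_symbols presented_symbols"
    unfolding presented_symbols_def
    by (intro comm_group.iso_image_Mod abelian_free_Abelian_group free_symbol_action_iso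
        symbol_relation_subgroup free_symbol_action_subgroup g)
  have "(`) ((`) (free_symbol_action \<gamma>)) \<in> iso mixed_symbols mixed_symbols"
    unfolding mixed_symbols_def
    by (intro comm_group.iso_image_Mod comm_group.iso_image_torsion comm_group_presented_symbols
         comm_group.subgroup_torsion 1)
  moreover have "mixed_symbol_action \<gamma> = (`) ((`) (free_symbol_action \<gamma>))"
    by (auto simp: mixed_symbol_action_def)
  ultimately show ?thesis by simp
qed

lemma mixed_symbol_in:
  assumes "g \<in> carrier SL2Z" "g' \<in> carrier SL2Z"
  shows "mixed_symbol g g' \<in> carrier mixed_symbols"
  using assms by (auto simp: mixed_symbol_def mixed_symbols_def presented_symbols_def carrier_FactGroup)

lemma mixed_symbol_action_symbol:
  assumes g: "\<gamma> \<in> carrier SL2Z" "g' \<in> carrier SL2Z" "g'' \<in> carrier SL2Z"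
  shows "mixed_symbol_action \<gamma> (mixed_symbol g' g'') = mixed_symbol (\<gamma> ** g') (\<gamma> ** g'')"
proof -
  let ?F = "free_Abelian_group symbol_pairs"
  let ?c = "symbol_relation_subgroup #>\<^bsub>?F\<^esub> frag_of (g', g'')"
  have 1: "(`) (free_symbol_action \<gamma>) \<in> iso presented_symbols presented_symbols"
    unfolding presented_symbols_def
    by (intro comm_group.iso_image_Mod abelian_free_Abelian_group free_symbol_action_iso
        symbol_relation_subgroup free_symbol_action_subgroup g)
  have "free_symbol_action \<gamma> ` ?c = symbol_relation_subgroup #>\<^bsub>?F\<^esub> free_symbol_action \<gamma> (frag_of (g', g''))"
    using g by (intro group.hom_image_coset group_free_Abelian_group free_symbol_action_hom
       free_symbol_action_subgroup subgroup.subset[OF symbol_relation_subgroup]) auto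
  then have 2: "free_symbol_action \<gamma> ` ?c = symbol_relation_subgroup #>\<^bsub>?F\<^esub> frag_of (\<gamma> ** g', \<gamma> ** g'')"
    by (simp add: free_symbol_action_def)
  have "((`) (free_symbol_action \<gamma>)) ` (torsion_subgroup presented_symbols #>\<^bsub>presented_symbols\<^esub> ?c)
      = torsion_subgroup presented_symbols #>\<^bsub>presented_symbols\<^esub> (free_symbol_action \<gamma> ` ?c)"
  proof (rule group.hom_image_coset)
    show "Group.group presented_symbols" using comm_group_presented_symbols by (rule comm_group.axioms)
    show "(`) (free_symbol_action \<gamma>) \<in> hom presented_symbols presented_symbols"
      using 1 by (simp add: iso_def)
    show "torsion_subgroup presented_symbols \<subseteq> carrier presented_symbols"
      by (auto simp: torsion_subgroup_def)
    show "(`) (free_symbol_action \<gamma>) ` torsion_subgroup presented_symbols = torsion_subgroup presented_symbols"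
      by (intro comm_group.iso_image_torsion comm_group_presented_symbols 1)
    show "?c \<in> carrier presented_symbols"
      using g by (auto simp: presented_symbols_def carrier_FactGroup)
  qed
  then show ?thesis by (simp add: mixed_symbol_action_def mixed_symbol_def 2)
qed

lemma coinvariant_kernel_in:
  assumes G: "\<Gamma> \<subseteq> carrier SL2Z"
  shows "coinvariant_kernel \<Gamma> \<in> coinvariant_subgroups \<Gamma>"
proof -
  let ?M = mixed_symbols
  interpret M: comm_group ?M by (rule comm_group_mixed_symbols)
  have act: "mixed_symbol_action \<gamma> x \<in> carrier ?M" if "\<gamma> \<in> \<Gamma>" "x \<in> carrier ?M" for \<gamma> x
    using mixed_symbol_action_iso[of \<gamma>] G that by (auto simp: iso_def hom_def)
  have iff: "N \<in> coinvariant_subgroups \<Gamma> \<longleftrightarrow> subgroup N ?M \<and>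
     (\<forall>x\<in>carrier ?M. \<forall>n::nat. n > 0 \<longrightarrow> x [^]\<^bsub>?M\<^esub> n \<in> N \<longrightarrow> x \<in> N) \<and>
     (\<forall>\<gamma>\<in>\<Gamma>. \<forall>x\<in>carrier ?M. mixed_symbol_action \<gamma> x \<otimes>\<^bsub>?M\<^esub> inv\<^bsub>?M\<^esub> x \<in> N)" for N
  proof (cases "subgroup N ?M")
    case True
    have "N #>\<^bsub>?M\<^esub> y = N #>\<^bsub>?M\<^esub> x \<longleftrightarrow> y \<otimes>\<^bsub>?M\<^esub> inv\<^bsub>?M\<^esub> x \<in> N"
      if "x \<in> carrier ?M" "y \<in> carrier ?M" for x y
    proof -
      have "N #>\<^bsub>?M\<^esub> y = N #>\<^bsub>?M\<^esub> x \<longleftrightarrow> y \<in> N #>\<^bsub>?M\<^esub> x"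
      proof
        assume "N #>\<^bsub>?M\<^esub> y = N #>\<^bsub>?M\<^esub> x"
        then show "y \<in> N #>\<^bsub>?M\<^esub> x" using M.rcos_self[OF that(2) True] by simp
      next
        assume "y \<in> N #>\<^bsub>?M\<^esub> x"
        then show "N #>\<^bsub>?M\<^esub> y = N #>\<^bsub>?M\<^esub> x"
          using M.repr_independence[OF _ that(1) True] by simp
      qed
      then show ?thesis using subgroup.rcos_module[OF True M.is_group that] by simp
    qed
    then show ?thesis
      using True act unfolding coinvariant_subgroups_def mem_Collect_eq M.torsion_free_Mod_iff[OF True]
      by (intro conj_cong refl ball_cong) simp
  qed (simp add: coinvariant_subgroups_def)
  have "carrier ?M \<in> coinvariant_subgroups \<Gamma>"
    unfolding iff using act M.subgroup_self by (intro conjI ballI allI impI) simp_all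
  then have ne: "coinvariant_subgroups \<Gamma> \<noteq> {}" by auto
  have "subgroup (coinvariant_kernel \<Gamma>) ?M"
    unfolding coinvariant_kernel_def using ne by (intro M.subgroups_Inter) (simp_all add: coinvariant_subgroups_def)
  moreover have "x \<in> coinvariant_kernel \<Gamma>"
    if "x \<in> carrier ?M" "n > 0" "x [^]\<^bsub>?M\<^esub> n \<in> coinvariant_kernel \<Gamma>" for x and n :: nat
    unfolding coinvariant_kernel_def
  proof
    fix N assume N: "N \<in> coinvariant_subgroups \<Gamma>"
    then have "x [^]\<^bsub>?M\<^esub> n \<in> N" using that(3) by (auto simp: coinvariant_kernel_def)
    then show "x \<in> N" using N that(1,2) unfolding iff by blast
  qed
  moreover have "mixed_symbol_action \<gamma> x \<otimes>\<^bsub>?M\<^esub> inv\<^bsub>?M\<^esub> x \<in> coinvariant_kernel \<Gamma>"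
    if "\<gamma> \<in> \<Gamma>" "x \<in> carrier ?M" for \<gamma> x
    unfolding coinvariant_kernel_def
  proof
    fix N assume "N \<in> coinvariant_subgroups \<Gamma>"
    then show "mixed_symbol_action \<gamma> x \<otimes>\<^bsub>?M\<^esub> inv\<^bsub>?M\<^esub> x \<in> N" using that unfolding iff by blast
  qed
  ultimately show ?thesis
    unfolding iff by blast
qed

lemma comm_group_mixed_symbols_mod:
  assumes G: "\<Gamma> \<subseteq> carrier SL2Z"
  shows "comm_group (mixed_symbols_mod \<Gamma>)"
  unfolding mixed_symbols_mod_def
  using coinvariant_kernel_in[OF G]
  by (intro comm_group.abelian_FactGroup comm_group_mixed_symbols) (simp add: coinvariant_subgroups_def)

lemma mixed_symbol_uminus:
  assumes "g \<in> carrier SL2Z" "g' \<in> carrier SL2Z"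
  shows "mixed_symbol (- g) (- g') = mixed_symbol g g'"
proof -
  let ?F = "free_Abelian_group symbol_pairs"
  interpret F: comm_group ?F by (rule abelian_free_Abelian_group)
  have "frag_of (g, g') - frag_of ((- mat 1) ** g, (- mat 1) ** g') \<in> symbol_relations"
    using assms unfolding symbol_relations_def by blast
  then have "frag_of (g, g') - frag_of (- g, - g') \<in> symbol_relation_subgroup"
    by (simp add: minus_one_mult symbol_relation_subgroup_def generate.incl)
  then have "frag_of (g, g') \<otimes>\<^bsub>?F\<^esub> inv\<^bsub>?F\<^esub> frag_of (- g, - g') \<in> symbol_relation_subgroup"
    using assms by (simp add: minus_in_SL2Z)
  then have "frag_of (g, g') \<in> symbol_relation_subgroup #>\<^bsub>?F\<^esub> frag_of (- g, - g')"
    using assms by (subst subgroup.rcos_module[OF symbol_relation_subgroup F.is_group])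
      (auto simp: minus_in_SL2Z)
  then have "symbol_relation_subgroup #>\<^bsub>?F\<^esub> frag_of (- g, - g')
       = symbol_relation_subgroup #>\<^bsub>?F\<^esub> frag_of (g, g')"
    using assms by (intro F.repr_independence symbol_relation_subgroup) (auto simp: minus_in_SL2Z)
  then show ?thesis by (simp add: mixed_symbol_def)
qed

lemma manin_symbol_coset:
  assumes G: "subgroup \<Gamma> SL2Z" and g: "g \<in> carrier SL2Z"
  shows "manin_symbol \<Gamma> (PSL2Z_coset \<Gamma> g) = mixed_symbol_mod \<Gamma> g (g ** matS)"
proof -
  interpret S: group SL2Z by (rule group_SL2Z)
  have N: "{mat 1, - mat 1} \<lhd> SL2Z" by (rule pm_normal)
  have GS: "\<Gamma> \<subseteq> carrier SL2Z" using G by (rule subgroup.subset)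
  define h where "h = (SOME h. h \<in> carrier SL2Z \<and> PSL2Z_coset \<Gamma> h = PSL2Z_coset \<Gamma> g)"
  have "h \<in> carrier SL2Z \<and> PSL2Z_coset \<Gamma> h = PSL2Z_coset \<Gamma> g"
    unfolding h_def by (rule someI[of _ g]) (use g in simp)
  then have h: "h \<in> carrier SL2Z" "PSL2Z_coset \<Gamma> h = PSL2Z_coset \<Gamma> g" by auto
  have mul: "to_PSL2Z a \<otimes>\<^bsub>PSL2Z\<^esub> to_PSL2Z b = to_PSL2Z (a ** b)"
    if "a \<in> carrier SL2Z" "b \<in> carrier SL2Z" for a b
    using that normal.rcos_sum[OF N] by (simp add: to_PSL2Z_def PSL2Z_def mult_SL2Z)
  have "mat 1 \<in> \<Gamma>" using subgroup.one_closed[OF G] by (simp add: SL2Z_def)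
  then have "to_PSL2Z (mat 1) \<otimes>\<^bsub>PSL2Z\<^esub> to_PSL2Z h \<in> PSL2Z_coset \<Gamma> h"
    unfolding PSL2Z_coset_def r_coset_def by blast
  then have "to_PSL2Z h \<in> PSL2Z_coset \<Gamma> g"
    using mul[of "mat 1" h] h GS \<open>mat 1 \<in> \<Gamma>\<close> by (simp add: subset_iff)
  then obtain \<gamma> where \<gamma>1: "\<gamma> \<in> \<Gamma>" "to_PSL2Z h = to_PSL2Z \<gamma> \<otimes>\<^bsub>PSL2Z\<^esub> to_PSL2Z g"
    unfolding PSL2Z_coset_def r_coset_def by blast
  then have \<gamma>: "\<gamma> \<in> \<Gamma>" "to_PSL2Z h = to_PSL2Z (\<gamma> ** g)"
    using mul[OF subsetD[OF GS] g] by simp_all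
  have \<gamma>S: "\<gamma> \<in> carrier SL2Z" using \<gamma> GS by auto
  have *: "to_PSL2Z a = {a, - a}" for a
    by (auto simp: to_PSL2Z_def r_coset_def mult_SL2Z minus_one_mult)
  have "h = \<gamma> ** g \<or> h = - (\<gamma> ** g)" using \<gamma>(2) by (auto simp: * doubleton_eq_iff)
  moreover have mm: "(- a) ** b = - (a ** b)" for a b :: "int^2^2"
    by (simp add: vec_eq_iff matrix_matrix_mult_def sum_2)
  moreover have "mixed_symbol (- (\<gamma> ** g)) (- (\<gamma> ** g ** matS)) = mixed_symbol (\<gamma> ** g) (\<gamma> ** g ** matS)"
    using \<gamma>S g matS_in by (intro mixed_symbol_uminus mult_in_SL2Z)
  ultimately have "mixed_symbol h (h ** matS) = mixed_symbol (\<gamma> ** g) (\<gamma> ** g ** matS)"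
    by (elim disjE) (simp_all only: mm)
  also have "\<dots> = mixed_symbol_action \<gamma> (mixed_symbol g (g ** matS))"
    using \<gamma>S g matS_in by (simp add: mixed_symbol_action_symbol mult_in_SL2Z matrix_mul_assoc)
  finally have "mixed_symbol_mod \<Gamma> h (h ** matS) = mixed_symbol_mod \<Gamma> g (g ** matS)"
    using coinvariant_kernel_in[OF GS] \<gamma> mixed_symbol_in[of g "g ** matS"] g matS_in
    by (simp add: mixed_symbol_mod_def coinvariant_subgroups_def mult_in_SL2Z)
  then show ?thesis by (simp add: manin_symbol_def Let_def h_def)
qed

lemma PSL2Z_cosets_eq: "PSL2Z_cosets \<Gamma> = PSL2Z_coset \<Gamma> ` carrier SL2Z"
  by (auto simp: PSL2Z_cosets_def PSL2Z_coset_def RCOSETS_def PSL2Z_def FactGroup_def to_PSL2Z_def)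

lemma manin_symbol_in:
  assumes G: "subgroup \<Gamma> SL2Z" and c: "c \<in> PSL2Z_cosets \<Gamma>"
  shows "manin_symbol \<Gamma> c \<in> carrier (mixed_symbols_mod \<Gamma>)"
  using assms
  by (auto simp: PSL2Z_cosets_eq manin_symbol_coset mixed_symbol_mod_def mixed_symbols_mod_def
      carrier_FactGroup mixed_symbol_in mult_in_SL2Z matS_in)

lemma manin_map_coset:
  assumes G: "subgroup \<Gamma> SL2Z" and g: "g \<in> carrier SL2Z"
  shows "manin_map \<Gamma> (frag_of (PSL2Z_coset \<Gamma> g)) = mixed_symbol_mod \<Gamma> g (g ** matS)"
proof -
  interpret M: comm_group "mixed_symbols_mod \<Gamma>"
    by (rule comm_group_mixed_symbols_mod[OF subgroup.subset[OF G]])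
  have "manin_symbol \<Gamma> (PSL2Z_coset \<Gamma> g) \<in> carrier (mixed_symbols_mod \<Gamma>)"
    using g by (intro manin_symbol_in[OF G]) (simp add: PSL2Z_cosets_eq)
  then show ?thesis
    by (simp add: manin_map_def manin_symbol_coset[OF G g] M.finprod_singleton_swap)
qed

lemma manin_map_hom:
  assumes G: "subgroup \<Gamma> SL2Z"
  shows "manin_map \<Gamma> \<in> hom (free_Abelian_group (PSL2Z_cosets \<Gamma>)) (mixed_symbols_mod \<Gamma>)"
proof -
  let ?M = "mixed_symbols_mod \<Gamma>"
  let ?t = "\<lambda>x c. manin_symbol \<Gamma> c [^]\<^bsub>?M\<^esub> Poly_Mapping.lookup x c"
  interpret M: comm_group ?M
    by (rule comm_group_mixed_symbols_mod[OF subgroup.subset[OF G]])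
  note mem = manin_symbol_in[OF G]
  have ext: "manin_map \<Gamma> x = finprod ?M (?t x) A"
    if "Poly_Mapping.keys x \<subseteq> A" "finite A" "A \<subseteq> PSL2Z_cosets \<Gamma>" for x A
    unfolding manin_map_def using that mem
    by (intro M.finprod_mono_neutral_cong_left) (auto simp: in_keys_iff)
  show ?thesis
  proof (rule homI)
    fix x y
    assume "x \<in> carrier (free_Abelian_group (PSL2Z_cosets \<Gamma>))" "y \<in> carrier (free_Abelian_group (PSL2Z_cosets \<Gamma>))"
    then have xy: "Poly_Mapping.keys x \<subseteq> PSL2Z_cosets \<Gamma>" "Poly_Mapping.keys y \<subseteq> PSL2Z_cosets \<Gamma>" by auto
    show "manin_map \<Gamma> x \<in> carrier ?M"
      unfolding manin_map_def using xy mem by (intro M.finprod_closed) auto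
    let ?A = "Poly_Mapping.keys x \<union> Poly_Mapping.keys y"
    have k: "Poly_Mapping.keys (x + y) \<subseteq> ?A" by (rule keys_add)
    have "finprod ?M (?t (x + y)) ?A = finprod ?M (\<lambda>c. ?t x c \<otimes>\<^bsub>?M\<^esub> ?t y c) ?A"
      using xy mem by (intro M.finprod_cong) (auto simp: simp_implies_def lookup_add M.int_pow_mult)
    also have "\<dots> = finprod ?M (?t x) ?A \<otimes>\<^bsub>?M\<^esub> finprod ?M (?t y) ?A"
      using xy mem by (intro M.finprod_multf) auto
    finally show "manin_map \<Gamma> (x \<otimes>\<^bsub>free_Abelian_group (PSL2Z_cosets \<Gamma>)\<^esub> y) = manin_map \<Gamma> x \<otimes>\<^bsub>?M\<^esub> manin_map \<Gamma> y"
      using xy k ext[of "x + y" ?A] ext[of x ?A] ext[of y ?A] by simp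
  qed
qed

end

(* Write V = TS and b(g) = {g, gT}. Modulo the image of the Manin map, {g, gS} vanishes, the three edges
   of a Farey triangle give b(g) + b(gTS) + b(gS) = 0, and comparing the two triangles that share an
   edge shows that b(gS) does not change when g is replaced by gT^2. As Gamma contains T and a lower
   unipotent matrix with odd entry, b is constant and 3b = 0, so the index is 1 or 3.

   If Gamma contains gVg^-1, then {g, gV} is a torsion element, hence 0, and b lies in the image. For
   Gamma_0(p^n) with p = 1 mod 3 such a g exists because d^2 + d + 1 has a root modulo p^n. Otherwise V
   has no fixed point on Gamma\PSL2(Z), and one constructs a homomorphism to Z that is divisible by 3 on
   the symbols {g, gS} but not on b: it sends {g, g'} to F(g') - F(g), where the increments A of F along S
   and B along T are functions on the finite set Gamma\PSL2(Z) that satisfy the Farey triangle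
   relation. With B = 1 - 3N at infinity and 1 at the other cusps, A = 3C, the relation is a system of
   linear equations on a finite connected graph, which is solvable over Z for N = #(V-orbits). *)

theory Submission
  imports Defs "HOL-Number_Theory.Residue_Primitive_Roots"
begin


section \<open>Matrices in SL2(Z)\<close>

text \<open>A symbol {g, g'} is read as a path in PSL2(Z), and b(g) depends only on the cusp g(oo).
  The odd entry matters because of the parity in the T^2-shift: it lets the lower unipotent matrix,
  together with translation by T, identify the cusps oo and 0. Crossing triangles then reaches every
  cusp, and three equal vertices give 3b = 0.

  For the lower bound F has to live on the whole group, as only its increments are functions on the
  finite quotient. Behind its existence is that PSL2(Z) is the free product of <S> of order 2 and
  <V> of order 3, so that the increments are subject only to one relation for S^2 and one for V^3.
  Here F is computed by Euclid's algorithm, and its compatibility with S is proved by descent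
  through Farey triangles.

  With B = 1 at the other cusps, the value 1 - 3N at oo is forced: summed over all cosets, the
  A-terms of the triangle relation cancel under S, so B has sum 0; there are 3N cosets when V has no
  fixed point, and oo, of width one, is a single coset. Connectedness alone would give a rational
  solution, but divisibility by 3 needs an integral C.\<close>

definition matTpow :: "int \<Rightarrow> int^2^2" where
  "matTpow m = vector [vector [1, m], vector [0, 1]]"

lemma mult_matS_nth [simp]:
  fixes g :: "int^2^2"
  shows "(g ** matS) $ i $ 1 = g $ i $ 2" "(g ** matS) $ i $ 2 = - g $ i $ 1"
  by (simp_all add: matrix_matrix_mult_def sum_2 matS_def)

lemma mult_matTpow_nth [simp]:
  fixes g :: "int^2^2"
  shows "(g ** matTpow m) $ i $ 1 = g $ i $ 1" "(g ** matTpow m) $ i $ 2 = m * g $ i $ 1 + g $ i $ 2"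
  by (simp_all add: matrix_matrix_mult_def sum_2 matTpow_def)

lemma mult_matT_nth [simp]:
  fixes g :: "int^2^2"
  shows "(g ** matT) $ i $ 1 = g $ i $ 1" "(g ** matT) $ i $ 2 = g $ i $ 1 + g $ i $ 2"
  by (simp_all add: matrix_matrix_mult_def sum_2 matT_def)

lemma mat2_eq_iff:
  fixes g h :: "int^2^2"
  shows "g = h \<longleftrightarrow> g$1$1 = h$1$1 \<and> g$1$2 = h$1$2 \<and> g$2$1 = h$2$1 \<and> g$2$2 = h$2$2"
  by (auto simp: vec_eq_iff forall_2)

lemma mat_one_nth [simp]:
  "(mat 1 :: int^2^2)$1$1 = 1" "(mat 1 :: int^2^2)$1$2 = 0"
  "(mat 1 :: int^2^2)$2$1 = 0" "(mat 1 :: int^2^2)$2$2 = 1"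
  by (simp_all add: mat_def)

lemma SL2Z_iff: "g \<in> carrier SL2Z \<longleftrightarrow> g$1$1 * g$2$2 - g$1$2 * g$2$1 = 1"
  by (simp add: SL2Z_def det_2)

lemma one_in_SL2Z: "mat 1 \<in> carrier SL2Z"
  by (simp add: SL2Z_iff)

lemma matTpow_in: "matTpow m \<in> carrier SL2Z"
  by (simp add: SL2Z_iff matTpow_def)

lemma minus_matrix_mult: "(- g) ** h = - (g ** h)" for g h :: "int^2^2"
  by (simp add: vec_eq_iff matrix_matrix_mult_def sum_2)

lemma matrix_mult_minus: "g ** (- h) = - (g ** h)" for g h :: "int^2^2"
  by (simp add: vec_eq_iff matrix_matrix_mult_def sum_2)

lemma matTpow_1: "matTpow 1 = matT"
  by (simp add: matTpow_def matT_def)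

lemma mult_matTpow_0 [simp]: "g ** matTpow 0 = g" for g :: "int^2^2"
  by (simp add: mat2_eq_iff)

lemma mult_matTpow_add: "g ** matTpow m ** matTpow k = g ** matTpow (m + k)" for g :: "int^2^2"
  by (simp add: mat2_eq_iff algebra_simps)

lemma mult_matS_matS: "g ** matS ** matS = - g" for g :: "int^2^2"
  by (simp add: mat2_eq_iff)

lemma matT_int_pow: "matT [^]\<^bsub>SL2Z\<^esub> (m :: int) = matTpow m"
proof -
  interpret group SL2Z by (rule group_SL2Z)
  have nat: "matT [^]\<^bsub>SL2Z\<^esub> (n :: nat) = matTpow (int n)" for n
  proof (induction n)
    case 0
    then show ?case by (simp add: mat2_eq_iff matTpow_def) (simp add: SL2Z_def)
  next
    case (Suc n)
    then show ?case by (simp add: mult_SL2Z mat2_eq_iff) (simp add: matTpow_def)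
  qed
  show ?thesis
  proof (cases "m \<ge> 0")
    case True
    then show ?thesis using nat[of "nat m"] int_pow_int[of SL2Z matT "nat m"]  by simp
  next
    case False
    then obtain n where n: "m = - int n"
      by (metis int_cases2 int_nat_eq nat_int of_nat_0_le_iff)
    have "matT [^]\<^bsub>SL2Z\<^esub> m = inv\<^bsub>SL2Z\<^esub> matTpow (int n)"
      unfolding n int_pow_neg_int[OF matT_in] nat ..
    also have "\<dots> = matTpow m"
      unfolding inv_SL2Z_eq[OF matTpow_in] by (simp add: matTpow_def n)
    finally show ?thesis .
  qed
qed

lemma SL2Z_upper_triangular:
  assumes "g \<in> carrier SL2Z" "g$2$1 = 0"
  shows "g = matTpow (g$1$1 * g$1$2) \<or> g = - matTpow (g$1$1 * g$1$2)"
proof -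
  have "g$1$1 * g$2$2 = 1" using assms by (simp add: SL2Z_iff)
  then have "g$1$1 = 1 \<and> g$2$2 = 1 \<or> g$1$1 = -1 \<and> g$2$2 = -1"
    using zmult_eq_1_iff by blast
  then show ?thesis using assms by (auto simp: mat2_eq_iff matTpow_def)
qed

text \<open>Euclid's algorithm on the bottom row (c, d): for c \<noteq> 0, right multiplication by
  T^(-m) with m = d div c and then by S replaces c by d mod c. For c = 0 the matrix is a power of T
  up to sign, and the sign comes from S^2 = -1.\<close>

lemma SL2Z_induct [consumes 1, case_names one S T T_inv]:
  assumes g: "g \<in> carrier SL2Z"
    and 1: "P (mat 1)"
    and S: "\<And>g. g \<in> carrier SL2Z \<Longrightarrow> P g \<Longrightarrow> P (g ** matS)"
    and T: "\<And>g. g \<in> carrier SL2Z \<Longrightarrow> P g \<Longrightarrow> P (g ** matT)"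
    and T_inv: "\<And>g. g \<in> carrier SL2Z \<Longrightarrow> P g \<Longrightarrow> P (g ** matTpow (- 1))"
  shows "P g"
proof -
  note mem = mult_in_SL2Z matS_in matTpow_in matT_in minus_in_SL2Z
  have Tpow: "P (g ** matTpow m)" if "g \<in> carrier SL2Z" "P g" for g m
  proof (induction m rule: int_induct[where k = 0])
    case base
    then show ?case using that by simp
  next
    case (step1 i)
    then show ?case using T[of "g ** matTpow i"] that mem
      by (simp add: matTpow_1[symmetric] mult_matTpow_add)
  next
    case (step2 i)
    then show ?case using T_inv[of "g ** matTpow i"] that mem
      by (simp add: mult_matTpow_add)
  qed
  have neg: "P (- g)" if "g \<in> carrier SL2Z" "P g" for g
    using S[OF _ S[OF that]] that mem by (simp add: mult_matS_matS)
  show ?thesis using g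
  proof (induction "nat \<bar>g$2$1\<bar>" arbitrary: g rule: less_induct)
    case less
    show ?case
    proof (cases "g$2$1 = 0")
      case True
      have "P (matTpow m)" for m
        using Tpow[OF one_in_SL2Z 1, of m] by simp
      then show ?thesis using SL2Z_upper_triangular[OF less.prems True] neg[OF matTpow_in] by metis
    next
      case False
      define m where "m = g$2$2 div g$2$1"
      define h where "h = g ** matTpow (- m)"
      have h: "h \<in> carrier SL2Z" using less.prems mem by (simp add: h_def)
      have "(h ** matS)$2$1 = g$2$2 mod g$2$1"
        by (simp add: h_def m_def minus_div_mult_eq_mod[symmetric])
      then have "nat \<bar>(h ** matS)$2$1\<bar> < nat \<bar>g$2$1\<bar>"
        using False abs_mod_less[of "g$2$1" "g$2$2"] by simp
      then have "P (h ** matS)" using less.hyps h mem by blast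
      then have "P (- (h ** matS ** matS))" using neg S h mem by metis
      then have "P (h ** matTpow m)" using Tpow h by (simp add: mult_matS_matS)
      then show ?thesis by (simp add: h_def mult_matTpow_add)
    qed
  qed
qed

section \<open>Potentials of Farey cocycles\<close>

text \<open>The values of \<open>potential A B\<close> are forced by \<open>F (g ** matT) = F g + B g\<close>,
  \<open>F (g ** matS) = F g + A g\<close> and \<open>F (mat 1) = 0\<close>: the recursion is Euclid's algorithm on the
  bottom row.\<close>

function potential :: "(int^2^2 \<Rightarrow> int) \<Rightarrow> (int^2^2 \<Rightarrow> int) \<Rightarrow> int^2^2 \<Rightarrow> int" where
  "potential A B g =
     (if g$2$1 = 0 then g$1$1 * g$1$2 * B (mat 1)
      else let m = g$2$2 div g$2$1; h = g ** matTpow (- m)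
           in m * B g + potential A B (h ** matS) - A h)"
  by auto
termination
proof (relation "measure (\<lambda>(A, B, g). nat \<bar>g$2$1\<bar>)")
  fix A B :: "int^2^2 \<Rightarrow> int" and g :: "int^2^2" and m h
  assume "g$2$1 \<noteq> 0" "m = g$2$2 div g$2$1" "h = g ** matTpow (- m)"
  then show "((A, B, h ** matS), (A, B, g)) \<in> measure (\<lambda>(A, B, g). nat \<bar>g$2$1\<bar>)"
    using abs_mod_less[of "g$2$1" "g$2$2"] by (simp add: minus_div_mult_eq_mod[symmetric])
qed simp

declare potential.simps [simp del]

text \<open>The rotation of the basic Farey triangle: V sends oo to 1, 1 to 0 and 0 to oo, and V^3 =
  -1.\<close>

abbreviation matV :: "int^2^2" where "matV \<equiv> matT ** matS"

lemma mult_matV_nth [simp]: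
  fixes g :: "int^2^2"
  shows "(g ** matV) $ i $ 1 = g $ i $ 1 + g $ i $ 2" "(g ** matV) $ i $ 2 = - g $ i $ 1"
  by (simp_all add: matrix_mul_assoc)

text \<open>\<open>A\<close> and \<open>B\<close> prescribe the increments of a potential along g ->
  gS and g -> gT. \<open>A_S\<close> and \<open>triangle\<close> reflect the relations S^2 = -1 and
  V^3 = -1, the latter along the closed path g, gT, gV, gVT, ..., -g. \<open>B_T\<close> makes the
  increments linear along powers of T, as {g, gT^m} = m {g, gT} demands.\<close>

locale edge_cocycle =
  fixes A B :: "int^2^2 \<Rightarrow> int"
  assumes A_minus: "g \<in> carrier SL2Z \<Longrightarrow> A (- g) = A g"
    and B_minus: "g \<in> carrier SL2Z \<Longrightarrow> B (- g) = B g"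
    and A_S: "g \<in> carrier SL2Z \<Longrightarrow> A (g ** matS) = - A g"
    and B_T: "g \<in> carrier SL2Z \<Longrightarrow> B (g ** matT) = B g"
    and triangle: "g \<in> carrier SL2Z \<Longrightarrow>
      B g + B (g ** matV) + B (g ** matV ** matV) +
      A (g ** matT) + A (g ** matV ** matT) + A (g ** matV ** matV ** matT) = 0"
begin

abbreviation F :: "int^2^2 \<Rightarrow> int" where "F \<equiv> potential A B"

lemmas mem = mult_in_SL2Z matS_in matT_in matTpow_in minus_in_SL2Z

lemma B_Tpow: "g \<in> carrier SL2Z \<Longrightarrow> B (g ** matTpow m) = B g"
proof (induction m rule: int_induct[where k = 0])
  case (step1 i)
  then show ?case using B_T[of "g ** matTpow i"] mem
    by (simp add: matTpow_1[symmetric] mult_matTpow_add)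
next
  case (step2 i)
  then show ?case using B_T[of "g ** matTpow (i - 1)"] mem
    by (simp add: matTpow_1[symmetric] mult_matTpow_add)
qed simp

lemma B_upper_triangular:
  assumes "g \<in> carrier SL2Z" "g$2$1 = 0"
  shows "B g = B (mat 1)"
proof -
  have "B (matTpow m) = B (mat 1)" for m
    using B_Tpow[OF one_in_SL2Z, of m] by simp
  then show ?thesis
    using SL2Z_upper_triangular[OF assms] B_minus[OF matTpow_in] by metis
qed

lemma F_minus: "g \<in> carrier SL2Z \<Longrightarrow> F (- g) = F g"
proof (induction "nat \<bar>g$2$1\<bar>" arbitrary: g rule: less_induct)
  case less
  show ?case
  proof (cases "g$2$1 = 0")
    case True
    then show ?thesis by (simp add: potential.simps[of A B g] potential.simps[of A B "- g"])
  next
    case False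
    define m where "m = g$2$2 div g$2$1"
    define h where "h = g ** matTpow (- m)"
    have h: "h \<in> carrier SL2Z" using less.prems mem by (simp add: h_def)
    have "nat \<bar>(h ** matS)$2$1\<bar> < nat \<bar>g$2$1\<bar>"
      using False abs_mod_less[of "g$2$1" "g$2$2"]
      by (simp add: h_def m_def minus_div_mult_eq_mod[symmetric])
    then have "F (- (h ** matS)) = F (h ** matS)" using less.hyps h mem by blast
    then show ?thesis
      using False h less.prems
      by (simp add: potential.simps[of A B g] potential.simps[of A B "- g"] Let_def
          minus_matrix_mult A_minus B_minus flip: m_def h_def)
  qed
qed

text \<open>For a nonzero lower left entry, \<open>g\<close> and \<open>g ** matTpow k\<close> have
  the same remainder in the first division step, so the recursion continues from the same matrix and
  only the quotient changes, by k.\<close>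

lemma F_Tpow:
  assumes g: "g \<in> carrier SL2Z"
  shows "F (g ** matTpow k) = F g + k * B g"
proof (cases "g$2$1 = 0")
  case True
  then have "g$1$1 * g$1$1 = 1"
    using g SL2Z_upper_triangular[OF g True] by (auto simp: mat2_eq_iff matTpow_def)
  then have "g$1$1 * (k * g$1$1 + g$1$2) = k + g$1$1 * g$1$2"
    by (simp add: distrib_left mult.left_commute)
  then have "F (g ** matTpow k) = (k + g$1$1 * g$1$2) * B (mat 1)"
    using True by (simp add: potential.simps[of A B "g ** matTpow k"])
  then show ?thesis using True B_upper_triangular[OF g True]
    by (simp add: potential.simps[of A B g] distrib_right)
next
  case False
  have *: "g ** matTpow k ** matTpow (- (k + m)) = g ** matTpow (- m)" for m
    by (simp add: mult_matTpow_add)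
  show ?thesis using False
    by (simp add: potential.simps[of A B g] potential.simps[of A B "g ** matTpow k"] Let_def *
        B_Tpow[OF g] algebra_simps del: minus_add_distrib)
qed

lemma F_T: "g \<in> carrier SL2Z \<Longrightarrow> F (g ** matT) = F g + B g"
  using F_Tpow[of g 1] by (simp add: matTpow_1)

text \<open>The first quotient is 0, so the recursion step is itself the formula.\<close>

lemma F_S_reduced:
  assumes "g$2$1 \<noteq> 0" "g$2$2 div g$2$1 = 0"
  shows "F (g ** matS) = F g + A g"
  using assms by (simp add: potential.simps[of A B g])

lemma F_S_flip:
  assumes "g \<in> carrier SL2Z" "F (g ** matS ** matS) = F (g ** matS) + A (g ** matS)"
  shows "F (g ** matS) = F g + A g"
  using assms F_minus[of g] A_S[of g] by (simp add: mult_matS_matS)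

text \<open>If the formula holds on two edges of a Farey triangle, then it holds on the third one.\<close>

lemma F_S_triangle:
  assumes g: "g \<in> carrier SL2Z"
    and 1: "F (g ** matT ** matS) = F (g ** matT) + A (g ** matT)"
    and 2: "F (g ** matV ** matT ** matS) = F (g ** matV ** matT) + A (g ** matV ** matT)"
  shows "F (g ** matS) = F g + A g"
proof -
  have 3: "g ** matV ** matV ** matT = g ** matS"
    by (simp add: mat2_eq_iff)
  have "F (g ** matV) = F g + B g + A (g ** matT)"
    using 1 F_T[OF g] by (simp add: matrix_mul_assoc)
  moreover have "F (g ** matV ** matV) = F (g ** matV) + B (g ** matV) + A (g ** matV ** matT)"
    using 2 F_T[of "g ** matV"] g mem by (simp add: matrix_mul_assoc)
  moreover have "F (g ** matS) = F (g ** matV ** matV) + B (g ** matV ** matV)"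
    using F_T[of "g ** matV ** matV"] g mem by (simp add: 3)
  ultimately show ?thesis using triangle[OF g] A_S[OF g] unfolding 3 by linarith
qed

text \<open>Descent on the larger entry, in absolute value, of the bottom row (c, d). The formula is
  the recursion itself if c \<noteq> 0 and d div c = 0, and \<open>F_S_flip\<close> exchanges (c, d)
  for (d, -c). The essential case is that of opposite signs with |d| \<le> |c|: there the second
  edge (c, c + d) of the triangle is reduced, and the third edge (c + d, d) is smaller or has c + d
  = 0.\<close>

lemma F_S: "g \<in> carrier SL2Z \<Longrightarrow> F (g ** matS) = F g + A g"
proof (induction "nat (max \<bar>g$2$1\<bar> \<bar>g$2$2\<bar>)" arbitrary: g rule: less_induct)
  case less
  have zero: "F (h ** matS) = F h + A h" if "h \<in> carrier SL2Z" "h$2$1 = 0" for h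
  proof (rule F_S_flip)
    have "h$2$2 \<noteq> 0" using that by (auto simp: SL2Z_iff)
    then show "F (h ** matS ** matS) = F (h ** matS) + A (h ** matS)"
      using that by (intro F_S_reduced) simp_all
  qed fact
  have opposite: "F (h ** matS) = F h + A h"
    if h: "h \<in> carrier SL2Z" and m: "nat (max \<bar>h$2$1\<bar> \<bar>h$2$2\<bar>) = nat (max \<bar>g$2$1\<bar> \<bar>g$2$2\<bar>)"
      and sgn: "h$2$1 > 0 \<and> h$2$2 < 0 \<or> h$2$1 < 0 \<and> h$2$2 > 0" and le: "\<bar>h$2$2\<bar> \<le> \<bar>h$2$1\<bar>" for h
  proof (rule F_S_triangle[OF h])
    have "(h$2$1 + h$2$2) div h$2$1 = 0"
      using sgn le by (auto intro: div_pos_pos_trivial div_neg_neg_trivial)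
    then show "F (h ** matT ** matS) = F (h ** matT) + A (h ** matT)"
      using sgn by (intro F_S_reduced) auto
    show "F (h ** matV ** matT ** matS) = F (h ** matV ** matT) + A (h ** matV ** matT)"
    proof (cases "h$2$1 + h$2$2 = 0")
      case True
      then show ?thesis using h mem by (intro zero) simp_all
    next
      case False
      then have "\<bar>h$2$1 + h$2$2\<bar> < \<bar>h$2$1\<bar>" "\<bar>h$2$2\<bar> < \<bar>h$2$1\<bar>"
        using sgn le by linarith+
      then have "nat (max \<bar>(h ** matV ** matT)$2$1\<bar> \<bar>(h ** matV ** matT)$2$2\<bar>)
          < nat (max \<bar>h$2$1\<bar> \<bar>h$2$2\<bar>)"
        by simp
      then have "nat (max \<bar>(h ** matV ** matT)$2$1\<bar> \<bar>(h ** matV ** matT)$2$2\<bar>)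
          < nat (max \<bar>g$2$1\<bar> \<bar>g$2$2\<bar>)"
        unfolding m .
      then show ?thesis by (rule less.hyps) (intro mem h)
    qed
  qed
  have ordered: "F (h ** matS) = F h + A h"
    if h: "h \<in> carrier SL2Z" and m: "nat (max \<bar>h$2$1\<bar> \<bar>h$2$2\<bar>) = nat (max \<bar>g$2$1\<bar> \<bar>g$2$2\<bar>)"
      and le: "\<bar>h$2$2\<bar> \<le> \<bar>h$2$1\<bar>" for h
  proof -
    have c0: "h$2$1 \<noteq> 0"
    proof
      assume "h$2$1 = 0"
      then show False using h le by (simp add: SL2Z_iff)
    qed
    consider "h$2$1 > 0 \<and> h$2$2 < 0 \<or> h$2$1 < 0 \<and> h$2$2 > 0" | "h$2$2 div h$2$1 = 0" | "h$2$2 = h$2$1"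
      using c0 le div_pos_pos_trivial[of "h$2$2" "h$2$1"] div_neg_neg_trivial[of "h$2$2" "h$2$1"]
      by linarith
    then show ?thesis
    proof cases
      case 1
      with h m show ?thesis by (rule opposite) (rule le)
    next
      case 2
      with c0 show ?thesis by (rule F_S_reduced)
    next
      \<comment> \<open>For c = d the quotient is 1; the flip turns (c, c) into (c, -c), which has
        opposite signs.\<close>
      case 3
      have "F (h ** matS ** matS) = F (h ** matS) + A (h ** matS)"
      proof (rule opposite)
        show "(h ** matS)$2$1 > 0 \<and> (h ** matS)$2$2 < 0 \<or> (h ** matS)$2$1 < 0 \<and> (h ** matS)$2$2 > 0"
          using 3 c0 by simp linarith
      qed (use 3 m in \<open>simp_all add: h mem\<close>)
      with h show ?thesis by (rule F_S_flip)
    qed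
  qed
  show ?case
  proof (cases "\<bar>g$2$2\<bar> \<le> \<bar>g$2$1\<bar>")
    case True
    show ?thesis by (rule ordered[OF less.prems refl True])
  next
    case False
    then have "F (g ** matS ** matS) = F (g ** matS) + A (g ** matS)"
      by (intro ordered mem less.prems) (simp_all add: max.commute)
    with less.prems show ?thesis by (rule F_S_flip)
  qed
qed

text \<open>Translation by \<gamma> preserves the increments of \<open>F\<close>, so it changes
  \<open>F\<close> by a constant only. Hence the differences F(h) - F(g), which become the values on
  symbols, are invariant although \<open>F\<close> need not be.\<close>

lemma F_equivariant:
  assumes \<gamma>: "\<gamma> \<in> carrier SL2Z"
    and inv: "\<And>g. g \<in> carrier SL2Z \<Longrightarrow> A (\<gamma> ** g) = A g" "\<And>g. g \<in> carrier SL2Z \<Longrightarrow> B (\<gamma> ** g) = B g"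
    and g: "g \<in> carrier SL2Z"
  shows "F (\<gamma> ** g) - F g = F \<gamma> - F (mat 1)"
  using g
proof (induction rule: SL2Z_induct)
  case one
  then show ?case by simp
next
  case (S g)
  then show ?case
    using F_S[of "\<gamma> ** g"] F_S[of g] inv \<gamma> mem by (simp add: matrix_mul_assoc)
next
  case (T g)
  then show ?case
    using F_T[of "\<gamma> ** g"] F_T[of g] inv \<gamma> mem by (simp add: matrix_mul_assoc)
next
  case (T_inv g)
  then show ?case
    using F_Tpow[of "\<gamma> ** g" "- 1"] F_Tpow[of g "- 1"] inv \<gamma> mem by (simp add: matrix_mul_assoc)
qed

end


section \<open>Integral solutions on the quotient of the Farey tree\<close>

text \<open>The right-hand sides \<open>R\<close> for which \<open>C x + C (v x) + C (v (v x)) = R x\<close> has a solution that is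
  antisymmetric under \<open>s\<close> form a group.  If \<open>e y\<close> is the indicator function of the \<open>v\<close>-orbit of \<open>y\<close>,
  then the difference of the Dirac functions at \<open>s y\<close> and \<open>y\<close> solves the equation for
  \<open>e (s y) - e y\<close>, so by connectedness all \<open>e y\<close> agree modulo this group.  The constant
  function \<open>1\<close> is the sum of the \<open>e t\<close> over a transversal of the orbits, which gives \<open>N\<close> as the
  number of orbits.\<close>

lemma exists_antisymmetric_flow:
  fixes X :: "'a set" and v s :: "'a \<Rightarrow> 'a"
  assumes fin: "finite X"
    and vX: "\<And>x. x \<in> X \<Longrightarrow> v x \<in> X" and sX: "\<And>x. x \<in> X \<Longrightarrow> s x \<in> X"
    and v3: "\<And>x. x \<in> X \<Longrightarrow> v (v (v x)) = x" and v_ne: "\<And>x. x \<in> X \<Longrightarrow> v x \<noteq> x"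
    and s2: "\<And>x. x \<in> X \<Longrightarrow> s (s x) = x"
    and connected: "\<And>P x. P x0 \<Longrightarrow> (\<And>x. x \<in> X \<Longrightarrow> P x \<Longrightarrow> P (v x)) \<Longrightarrow>
      (\<And>x. x \<in> X \<Longrightarrow> P x \<Longrightarrow> P (s x)) \<Longrightarrow> x \<in> X \<Longrightarrow> P x"
  shows "\<exists>(C :: 'a \<Rightarrow> int) (N :: int). \<forall>x\<in>X. C (s x) = - C x \<and>
    C x + C (v x) + C (v (v x)) =
      N * (of_bool (x = x0) + of_bool (v x = x0) + of_bool (v (v x) = x0)) - 1"
proof -
  define e :: "'a \<Rightarrow> 'a \<Rightarrow> int" where
    "e y x = of_bool (x = y) + of_bool (v x = y) + of_bool (v (v x) = y)" for y x
  define good :: "('a \<Rightarrow> int) \<Rightarrow> bool" where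
    "good R \<longleftrightarrow> (\<exists>C. \<forall>x\<in>X. C (s x) = - C x \<and> C x + C (v x) + C (v (v x)) = R x)" for R
  have good_add: "good (\<lambda>x. R x + R' x)" if "good R" "good R'" for R R'
  proof -
    from that obtain C C' where
      "\<forall>x\<in>X. C (s x) = - C x \<and> C x + C (v x) + C (v (v x)) = R x"
      "\<forall>x\<in>X. C' (s x) = - C' x \<and> C' x + C' (v x) + C' (v (v x)) = R' x"
      unfolding good_def by blast
    then show ?thesis
      unfolding good_def by (intro exI[of _ "\<lambda>x. C x + C' x"]) fastforce
  qed
  have good_minus: "good (\<lambda>x. - R x)" if "good R" for R
  proof -
    from that obtain C where "\<forall>x\<in>X. C (s x) = - C x \<and> C x + C (v x) + C (v (v x)) = R x"
      unfolding good_def by blast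
    then show ?thesis
      unfolding good_def by (intro exI[of _ "\<lambda>x. - C x"]) fastforce
  qed
  have good_cong: "good R \<longleftrightarrow> good R'" if "\<And>x. x \<in> X \<Longrightarrow> R x = R' x" for R R'
    using that unfolding good_def by auto
  have good_0: "good (\<lambda>x. 0)"
    unfolding good_def by (intro exI[of _ "\<lambda>x. 0"]) simp
  have base: "good (\<lambda>x. e y x - e x0 x)" if "y \<in> X" for y
    using _ _ _ that
  proof (rule connected)
    show "good (\<lambda>x. e x0 x - e x0 x)" using good_0 by simp
  next
    fix y assume y: "y \<in> X" and IH: "good (\<lambda>x. e y x - e x0 x)"
    have eq: "v x = v y \<longleftrightarrow> x = y" if "x \<in> X" for x
      using v3[OF that] v3[OF y] by metis
    have "e (v y) x = e y x" if x: "x \<in> X" for x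
    proof -
      have "x = v y \<longleftrightarrow> v (v x) = y" using eq[OF vX[OF vX[OF x]]] v3[OF x] by auto
      moreover have "v (v x) = v y \<longleftrightarrow> v x = y" using eq[OF vX[OF x]] by simp
      ultimately show ?thesis using eq[OF x] by (simp add: e_def)
    qed
    then show "good (\<lambda>x. e (v y) x - e x0 x)" using IH by (subst good_cong) auto
  next
    fix y assume y: "y \<in> X" and IH: "good (\<lambda>x. e y x - e x0 x)"
    have 1: "s x = s y \<longleftrightarrow> x = y" if "x \<in> X" for x
      using s2[OF that] s2[OF y] by metis
    have 2: "s x = y \<longleftrightarrow> x = s y" if "x \<in> X" for x
      using s2[OF that] s2[OF y] by metis
    have "good (\<lambda>x. e (s y) x - e y x)"
      unfolding good_def
      by (intro exI[of _ "\<lambda>x. of_bool (x = s y) - of_bool (x = y)"]) (auto simp: 1 2 e_def)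
    from good_add[OF this IH] show "good (\<lambda>x. e (s y) x - e x0 x)" by simp
  qed
  have good_sum: "good (\<lambda>x. \<Sum>t\<in>T. e t x - e x0 x)" if "finite T" "T \<subseteq> X" for T
    using that by (induction T) (auto intro: good_0 good_add base)
  define orb where "orb x = {x, v x, v (v x)}" for x
  have orb_eq: "orb y = orb x" if "x \<in> X" "y \<in> orb x" for x y
    using that v3 by (auto simp: orb_def)
  have orb_X: "orb x \<subseteq> X" if "x \<in> X" for x
    using that vX by (simp add: orb_def)
  define r where "r x = (SOME y. y \<in> orb x)" for x
  have r: "r x \<in> orb x" for x
    unfolding r_def by (rule someI[of _ x]) (simp add: orb_def)
  have rX: "r ` X \<subseteq> X" using r orb_X by blast
  have unique: "(\<Sum>t\<in>r ` X. e t x) = 1" if x: "x \<in> X" for x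
  proof -
    \<comment> \<open>Without fixed points each orbit has three distinct elements, so
      \<open>e t\<close> takes only the values 0 and 1; at a fixed point it would take the value
      3.\<close>
    have d: "v x \<noteq> x" "v (v x) \<noteq> v x" "v (v x) \<noteq> x"
      using v_ne[OF x] v_ne[OF vX[OF x]] v_ne[OF vX[OF vX[OF x]]] v3[OF x] by metis+
    have "e t x = of_bool (t = r x)" if t: "t \<in> r ` X" for t
    proof -
      obtain y where y: "y \<in> X" "t = r y" using t by auto
      have "t = r x" if "t \<in> orb x"
      proof -
        have "orb x = orb y" using orb_eq[OF x that] orb_eq[OF y(1)] r y by simp
        then show ?thesis by (simp add: y r_def)
      qed
      then have "t \<in> orb x \<longleftrightarrow> t = r x" using r by blast
      moreover have "e t x = of_bool (t \<in> orb x)"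
        using d by (auto simp: e_def orb_def)
      ultimately show ?thesis by simp
    qed
    then have "(\<Sum>t\<in>r ` X. e t x) = (\<Sum>t\<in>r ` X. of_bool (t = r x))" by (intro sum.cong refl) blast
    also have "\<dots> = 1" using fin x by (simp add: of_bool_def)
    finally show ?thesis .
  qed
  have "good (\<lambda>x. - (\<Sum>t\<in>r ` X. e t x - e x0 x))"
    using good_minus good_sum fin rX by blast
  then have "good (\<lambda>x. int (card (r ` X)) * e x0 x - 1)"
    by (subst good_cong[where R' = "\<lambda>x. - (\<Sum>t\<in>r ` X. e t x - e x0 x)"])
       (simp_all add: sum_subtractf unique)
  then show ?thesis unfolding good_def e_def by blast
qed

section \<open>Cosets up to sign, and the cocycle that detects b modulo 3\<close>

definition pm_coset :: "(int^2^2) set \<Rightarrow> int^2^2 \<Rightarrow> (int^2^2) set" where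
  "pm_coset \<Gamma> g = (\<lambda>\<gamma>. \<gamma> ** g) ` \<Gamma> \<union> (\<lambda>\<gamma>. - (\<gamma> ** g)) ` \<Gamma>"

text \<open>The reason for encoding points of the coset space as sets of matrices closed under sign:
  right multiplication acts on them as a plain image.\<close>

lemma pm_coset_mult: "(\<lambda>h. h ** w) ` pm_coset \<Gamma> g = pm_coset \<Gamma> (g ** w)"
  by (simp add: pm_coset_def image_Un image_image minus_matrix_mult matrix_mul_assoc)

lemma pm_coset_minus: "pm_coset \<Gamma> (- g) = pm_coset \<Gamma> g"
  by (auto simp: pm_coset_def matrix_mult_minus)

lemma pm_coset_left:
  assumes "subgroup \<Gamma> SL2Z" "\<gamma> \<in> \<Gamma>"
  shows "pm_coset \<Gamma> (\<gamma> ** g) = pm_coset \<Gamma> g"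
proof -
  interpret S: group SL2Z by (rule group_SL2Z)
  have "\<gamma> \<in> carrier SL2Z" using assms subgroup.subset by blast
  then have "(\<lambda>h. h ** \<gamma>) ` \<Gamma> = \<Gamma>"
    using S.coset_join2[OF _ assms] by (auto simp: r_coset_def mult_SL2Z)
  then have *: "(\<lambda>h. f (h ** \<gamma>)) ` \<Gamma> = f ` \<Gamma>" for f :: "int^2^2 \<Rightarrow> int^2^2"
    by (metis image_image)
  show ?thesis
    using *[of "\<lambda>h. h ** g"] *[of "\<lambda>h. - (h ** g)"] by (simp add: pm_coset_def matrix_mul_assoc)
qed

lemma pm_coset_eqD:
  assumes "subgroup \<Gamma> SL2Z" "pm_coset \<Gamma> h = pm_coset \<Gamma> g"
  obtains \<gamma> where "\<gamma> \<in> \<Gamma>" "h = \<gamma> ** g \<or> h = - (\<gamma> ** g)"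
proof -
  have "mat 1 \<in> \<Gamma>" using subgroup.one_closed[OF assms(1)] by (simp add: SL2Z_def)
  then have "h \<in> pm_coset \<Gamma> h" by (force simp: pm_coset_def)
  then show thesis using that unfolding assms(2) by (auto simp: pm_coset_def)
qed

text \<open>\<open>B\<close> is \<open>1\<close> at all cusps except \<open>\<infinity>\<close>, which has width one because \<open>matT \<in> \<Gamma>\<close>; the value at
  \<open>\<infinity>\<close> is the one that makes the sum of \<open>B\<close> over all cosets vanish.\<close>

lemma exists_edge_cocycle:
  assumes \<Gamma>: "subgroup \<Gamma> SL2Z" and fin: "finite (pm_coset \<Gamma> ` carrier SL2Z)" and T: "matT \<in> \<Gamma>"
    and no_fix: "\<And>g. g \<in> carrier SL2Z \<Longrightarrow> pm_coset \<Gamma> (g ** matV) \<noteq> pm_coset \<Gamma> g"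
  obtains A B where "edge_cocycle A B"
    "\<And>\<gamma> g. \<gamma> \<in> \<Gamma> \<Longrightarrow> A (\<gamma> ** g) = A g" "\<And>\<gamma> g. \<gamma> \<in> \<Gamma> \<Longrightarrow> B (\<gamma> ** g) = B g"
    "\<And>g. 3 dvd A g" "\<not> 3 dvd B (mat 1)"
proof -
  note mem = mult_in_SL2Z matS_in matT_in matTpow_in minus_in_SL2Z
  let ?\<pi> = "pm_coset \<Gamma>"
  \<comment> \<open>The triangle relation evaluates \<open>A\<close> after a step by T. Indexing
    \<open>C\<close> by the matrix before that step turns the reversal S into its conjugate
    TST^(-1), while V remains right multiplication.\<close>
  define R where "R = matT ** matS ** matTpow (- 1)"
  have R_mem: "R \<in> carrier SL2Z" unfolding R_def by (intro mem)
  have VVV: "g ** matV ** matV ** matV = - g" for g :: "int^2^2"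
    by (simp add: mat2_eq_iff)
  have RR: "g ** R ** R = - g" for g :: "int^2^2"
    by (simp add: R_def mat2_eq_iff matrix_mul_assoc)
  have conn: "P (?\<pi> g)"
    if "P (?\<pi> (mat 1))"
      and v: "\<And>g. g \<in> carrier SL2Z \<Longrightarrow> P (?\<pi> g) \<Longrightarrow> P (?\<pi> (g ** matV))"
      and s: "\<And>g. g \<in> carrier SL2Z \<Longrightarrow> P (?\<pi> g) \<Longrightarrow> P (?\<pi> (g ** R))"
      and "g \<in> carrier SL2Z" for P g
  proof -
    \<comment> \<open>V and R generate up to sign: RV = -T, V^2 R = -T^(-1) and S = T^(-1)
      V.\<close>
    have T: "P (?\<pi> (h ** matT))" if "h \<in> carrier SL2Z" "P (?\<pi> h)" for h
    proof -
      have "h ** matT = - (h ** R ** matV)" by (simp add: R_def mat2_eq_iff matrix_mul_assoc)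
      then show ?thesis using that v s mem R_mem by (simp add: pm_coset_minus)
    qed
    have T_inv: "P (?\<pi> (h ** matTpow (- 1)))" if "h \<in> carrier SL2Z" "P (?\<pi> h)" for h
    proof -
      have "h ** matTpow (- 1) = - (h ** matV ** matV ** R)"
        by (simp add: R_def mat2_eq_iff matrix_mul_assoc)
      then show ?thesis using that v s mem R_mem by (simp add: pm_coset_minus)
    qed
    have S: "P (?\<pi> (h ** matS))" if "h \<in> carrier SL2Z" "P (?\<pi> h)" for h
    proof -
      have "h ** matS = h ** matTpow (- 1) ** matV" by (simp add: mat2_eq_iff)
      then show ?thesis using v T_inv that mem by simp
    qed
    show ?thesis
      using that(4) by (induction rule: SL2Z_induct) (fact that(1), (erule (1) S T T_inv)+)
  qed
  have "\<exists>(C :: _ \<Rightarrow> int) (N :: int). \<forall>x\<in>?\<pi> ` carrier SL2Z. C ((\<lambda>h. h ** R) ` x) = - C x \<and>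
    C x + C ((\<lambda>h. h ** matV) ` x) + C ((\<lambda>h. h ** matV) ` (\<lambda>h. h ** matV) ` x) =
      N * (of_bool (x = ?\<pi> (mat 1)) + of_bool ((\<lambda>h. h ** matV) ` x = ?\<pi> (mat 1)) +
        of_bool ((\<lambda>h. h ** matV) ` (\<lambda>h. h ** matV) ` x = ?\<pi> (mat 1))) - 1"
  proof (rule exists_antisymmetric_flow[OF fin], goal_cases)
    case (1 x)
    then show ?case by (elim imageE) (simp only: pm_coset_mult imageI mem)
  next
    case (2 x)
    then show ?case by (elim imageE) (simp only: pm_coset_mult imageI mem R_mem)
  next
    case (3 x)
    then show ?case by (elim imageE) (simp only: pm_coset_mult VVV pm_coset_minus)
  next
    case (4 x)
    then show ?case by (elim imageE) (simp only: pm_coset_mult no_fix not_False_eq_True)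
  next
    case (5 x)
    then show ?case by (elim imageE) (simp only: pm_coset_mult RR pm_coset_minus)
  next
    case (6 P x)
    then obtain g where g: "g \<in> carrier SL2Z" "x = pm_coset \<Gamma> g" by blast
    have "P (pm_coset \<Gamma> g)"
    proof (rule conn[where P = P, OF 6(1) _ _ g(1)])
      fix h assume "h \<in> carrier SL2Z" "P (pm_coset \<Gamma> h)"
      then show "P (pm_coset \<Gamma> (h ** matV))" "P (pm_coset \<Gamma> (h ** R))"
        using 6(2,3)[of "pm_coset \<Gamma> h"] by (simp_all only: pm_coset_mult image_eqI)
    qed
    then show ?case by (simp only: g(2))
  qed
  then obtain C :: "_ \<Rightarrow> int" and N :: int where CN: "C ((\<lambda>h. h ** R) ` x) = - C x"
    "C x + C ((\<lambda>h. h ** matV) ` x) + C ((\<lambda>h. h ** matV) ` (\<lambda>h. h ** matV) ` x) =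
      N * (of_bool (x = ?\<pi> (mat 1)) + of_bool ((\<lambda>h. h ** matV) ` x = ?\<pi> (mat 1)) +
        of_bool ((\<lambda>h. h ** matV) ` (\<lambda>h. h ** matV) ` x = ?\<pi> (mat 1))) - 1"
    if "x \<in> ?\<pi> ` carrier SL2Z" for x
    by blast
  have C: "C (?\<pi> (g ** R)) = - C (?\<pi> g)"
    and sum: "C (?\<pi> g) + C (?\<pi> (g ** matV)) + C (?\<pi> (g ** matV ** matV)) =
      N * (of_bool (?\<pi> g = ?\<pi> (mat 1)) + of_bool (?\<pi> (g ** matV) = ?\<pi> (mat 1)) +
        of_bool (?\<pi> (g ** matV ** matV) = ?\<pi> (mat 1))) - 1"
    if "g \<in> carrier SL2Z" for g
    using CN[OF imageI[OF that]] by (simp_all only: pm_coset_mult)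
  \<comment> \<open>The constants 1 in the three values of \<open>B\<close> add up to 3, so the
    triangle relation becomes 3 times the equation for \<open>C\<close>. Modulo 3, \<open>A\<close>
    is 0 and \<open>B\<close> is 1.\<close>
  define A where "A g = 3 * C (?\<pi> (g ** matTpow (- 1)))" for g
  define B where "B g = 1 - 3 * N * of_bool (?\<pi> g = ?\<pi> (mat 1))" for g
  have TT: "g ** matT ** matTpow (- 1) = g" for g :: "int^2^2"
    by (simp add: mat2_eq_iff)
  show thesis
  proof (rule that)
    show "edge_cocycle A B"
    proof
      fix g :: "int^2^2" assume g: "g \<in> carrier SL2Z"
      show "A (- g) = A g" "B (- g) = B g"
        by (simp_all add: A_def B_def minus_matrix_mult pm_coset_minus)
      have "g ** matS ** matTpow (- 1) = g ** matTpow (- 1) ** R"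
        by (simp add: R_def mat2_eq_iff matrix_mul_assoc)
      then show "A (g ** matS) = - A g"
        using C[of "g ** matTpow (- 1)"] g mem by (simp add: A_def)
      have "?\<pi> matT = ?\<pi> (mat 1)"
        using pm_coset_left[OF \<Gamma> T, of "mat 1"] by simp
      then have "?\<pi> (g ** matT) = ?\<pi> (mat 1) \<longleftrightarrow> ?\<pi> g = ?\<pi> (mat 1)"
        using pm_coset_mult[of "matTpow (- 1)" \<Gamma> "g ** matT"] pm_coset_mult[of "matTpow (- 1)" \<Gamma> "mat 1 ** matT"]
          pm_coset_mult[of "matT" \<Gamma> g] pm_coset_mult[of "matT" \<Gamma> "mat 1"]
        unfolding TT by (metis matrix_mul_lid)
      then show "B (g ** matT) = B g" by (simp add: B_def)
      show "B g + B (g ** matV) + B (g ** matV ** matV) +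
          A (g ** matT) + A (g ** matV ** matT) + A (g ** matV ** matV ** matT) = 0"
        using sum[OF g] unfolding A_def B_def TT by (simp add: algebra_simps)
    qed
    show "A (\<gamma> ** g) = A g" "B (\<gamma> ** g) = B g" if "\<gamma> \<in> \<Gamma>" for \<gamma> g
      using pm_coset_left[OF \<Gamma> that] by (simp_all add: A_def B_def flip: matrix_mul_assoc)
    show "3 dvd A g" for g by (simp add: A_def)
    show "\<not> 3 dvd B (mat 1)" by (simp add: B_def) presburger
  qed
qed

text \<open>If g and h agree modulo N, then h g^(-1) is congruent to the identity and lies in
  \<open>Gamma1 N\<close>. So a coset is determined by four residues.\<close>

lemma finite_pm_cosets:
  assumes \<Gamma>: "subgroup \<Gamma> SL2Z" and sub: "Gamma1 N \<subseteq> \<Gamma>" and N: "N > 0"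
  shows "finite (pm_coset \<Gamma> ` carrier SL2Z)"
proof -
  define f where "f g = (g$1$1 mod int N, g$1$2 mod int N, g$2$1 mod int N, g$2$2 mod int N)"
    for g :: "int^2^2"
  have eq: "pm_coset \<Gamma> h = pm_coset \<Gamma> g"
    if g: "g \<in> carrier SL2Z" and h: "h \<in> carrier SL2Z" and fgh: "f h = f g" for g h
  proof -
    define \<gamma> :: "int^2^2" where "\<gamma> = h ** vector [vector [g$2$2, - g$1$2], vector [- g$2$1, g$1$1]]"
    have \<gamma>: "\<gamma>$1$1 = h$1$1 * g$2$2 - h$1$2 * g$2$1" "\<gamma>$1$2 = h$1$2 * g$1$1 - h$1$1 * g$1$2"
      "\<gamma>$2$1 = h$2$1 * g$2$2 - h$2$2 * g$2$1" "\<gamma>$2$2 = h$2$2 * g$1$1 - h$2$1 * g$1$2"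
      by (simp_all add: \<gamma>_def matrix_matrix_mult_def sum_2)
    have det: "g$1$1 * g$2$2 - g$1$2 * g$2$1 = 1" using g by (simp add: SL2Z_iff)
    have "h = \<gamma> ** g"
    proof -
      have "\<gamma> ** g = h ** (vector [vector [g$2$2, - g$1$2], vector [- g$2$1, g$1$1]] ** g)"
        by (simp add: \<gamma>_def matrix_mul_assoc)
      also have "vector [vector [g$2$2, - g$1$2], vector [- g$2$1, g$1$1]] ** g = mat 1"
        using det by (simp add: vec_eq_iff matrix_matrix_mult_def mat_def sum_2 forall_2 algebra_simps)
      finally show ?thesis by simp
    qed
    moreover have "\<gamma> \<in> \<Gamma>"
    proof -
      have c: "[h$i$j = g$i$j] (mod int N)" for i j
        using fgh exhaust_2[of i] exhaust_2[of j] by (auto simp: f_def cong_def)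
      have "[\<gamma>$1$1 = g$1$1 * g$2$2 - g$1$2 * g$2$1] (mod int N)"
        "[\<gamma>$2$1 = g$2$1 * g$2$2 - g$2$2 * g$2$1] (mod int N)"
        "[\<gamma>$2$2 = g$2$2 * g$1$1 - g$2$1 * g$1$2] (mod int N)"
        unfolding \<gamma> by (intro cong_diff cong_mult cong_refl c)+
      moreover have "\<gamma> \<in> carrier SL2Z"
        unfolding \<gamma>_def inv_SL2Z_eq[OF g, symmetric]
        by (intro mult_in_SL2Z h group.inv_closed group_SL2Z g)
      ultimately have "\<gamma> \<in> Gamma1 N" using det by (simp add: Gamma1_def algebra_simps)
      then show ?thesis using sub by blast
    qed
    ultimately show ?thesis using pm_coset_left[OF \<Gamma>] by simp
  qed
  have "f ` carrier SL2Z \<subseteq> {0..<int N} \<times> {0..<int N} \<times> {0..<int N} \<times> {0..<int N}"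
    using N by (auto simp: f_def)
  then have "finite (f ` carrier SL2Z)" by (rule finite_subset) simp
  moreover have "pm_coset \<Gamma> ` carrier SL2Z =
      (\<lambda>t. pm_coset \<Gamma> (SOME g. g \<in> carrier SL2Z \<and> f g = t)) ` f ` carrier SL2Z"
    unfolding image_image
  proof (rule image_cong[OF refl])
    fix g assume g: "g \<in> carrier SL2Z"
    define h where "h = (SOME h. h \<in> carrier SL2Z \<and> f h = f g)"
    have "h \<in> carrier SL2Z \<and> f h = f g"
      unfolding h_def by (rule someI[of _ g]) (simp add: g)
    then show "pm_coset \<Gamma> g = pm_coset \<Gamma> (SOME h. h \<in> carrier SL2Z \<and> f h = f g)"
      unfolding h_def[symmetric] using eq[OF g] by simp
  qed
  ultimately show ?thesis by simp
qed

section \<open>Elements of order three\<close>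

text \<open>Up to sign, \<gamma> is g V g^(-1). Its trace is that of V, which excludes
  \<open>Gamma1\<close>; its lower left entry is a binary quadratic form of discriminant -3 in the
  bottom row of g, which decides the case of \<open>Gamma0\<close>.\<close>

lemma conj_matV:
  fixes g \<gamma> :: "int^2^2"
  assumes g: "g \<in> carrier SL2Z" and eq: "\<gamma> ** g = g ** matV \<or> \<gamma> ** g = - (g ** matV)"
  shows "\<bar>\<gamma>$2$1\<bar> = \<bar>g$2$1 * g$2$1 + g$2$1 * g$2$2 + g$2$2 * g$2$2\<bar>" "\<bar>\<gamma>$1$1 + \<gamma>$2$2\<bar> = 1"
proof -
  have det: "g$1$1 * g$2$2 - g$1$2 * g$2$1 = 1" using g by (simp add: SL2Z_iff)
  define u where "u = \<gamma> ** g"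
  have u: "u$1$1 = \<gamma>$1$1 * g$1$1 + \<gamma>$1$2 * g$2$1" "u$1$2 = \<gamma>$1$1 * g$1$2 + \<gamma>$1$2 * g$2$2"
     "u$2$1 = \<gamma>$2$1 * g$1$1 + \<gamma>$2$2 * g$2$1" "u$2$2 = \<gamma>$2$1 * g$1$2 + \<gamma>$2$2 * g$2$2"
    by (simp_all add: u_def matrix_matrix_mult_def sum_2)
  have "\<gamma>$2$1 = \<gamma>$2$1 * (g$1$1 * g$2$2 - g$1$2 * g$2$1)" using det by simp
  also have "\<dots> = g$2$2 * u$2$1 - g$2$1 * u$2$2" by (simp add: u algebra_simps)
  finally have c: "\<gamma>$2$1 = g$2$2 * u$2$1 - g$2$1 * u$2$2" .
  have "\<gamma>$1$1 + \<gamma>$2$2 = (\<gamma>$1$1 + \<gamma>$2$2) * (g$1$1 * g$2$2 - g$1$2 * g$2$1)" using det by simp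
  also have "\<dots> = g$2$2 * u$1$1 - g$2$1 * u$1$2 + g$1$1 * u$2$2 - g$1$2 * u$2$1"
    by (simp add: u algebra_simps)
  finally have tr: "\<gamma>$1$1 + \<gamma>$2$2 = g$2$2 * u$1$1 - g$2$1 * u$1$2 + g$1$1 * u$2$2 - g$1$2 * u$2$1" .
  consider "u = g ** matV" | "u = - (g ** matV)" using eq by (auto simp: u_def)
  then have "(\<gamma>$2$1 = g$2$1 * g$2$1 + g$2$1 * g$2$2 + g$2$2 * g$2$2 \<or>
      \<gamma>$2$1 = - (g$2$1 * g$2$1 + g$2$1 * g$2$2 + g$2$2 * g$2$2)) \<and>
      (\<gamma>$1$1 + \<gamma>$2$2 = 1 \<or> \<gamma>$1$1 + \<gamma>$2$2 = - 1)"
    by cases (unfold c tr, insert det, simp_all add: algebra_simps)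
  then show "\<bar>\<gamma>$2$1\<bar> = \<bar>g$2$1 * g$2$1 + g$2$1 * g$2$2 + g$2$2 * g$2$2\<bar>" "\<bar>\<gamma>$1$1 + \<gamma>$2$2\<bar> = 1"
    by auto
qed

text \<open>The form divides c^3 - d^3, and for p = 3k + 2 cubing is injective on units modulo p:
  from c^(3k) = d^(3k) and c^(3k+1) = 1 = d^(3k+1) follows c = d. Then the form equals 3 d^2 modulo
  p.\<close>

lemma prime_dvd_loeschian:
  fixes c d :: int and p :: nat
  assumes p: "prime p" "[p = 2] (mod 3)" "p \<noteq> 2" and dvd: "int p dvd c * c + c * d + d * d"
  shows "int p dvd c \<and> int p dvd d"
proof (rule ccontr)
  assume n: "\<not> ?thesis"
  have pp: "prime (int p)" using p by simp
  have cd: "int p dvd c \<longleftrightarrow> int p dvd d"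
  proof
    assume "int p dvd c"
    then have "int p dvd d * d" using dvd by (metis dvd_add_right_iff dvd_mult2 dvd_add)
    then show "int p dvd d" using pp prime_dvd_mult_iff by blast
  next
    assume "int p dvd d"
    then have "int p dvd c * c" using dvd by (metis dvd_add_left_iff dvd_mult)
    then show "int p dvd c" using pp prime_dvd_mult_iff by blast
  qed
  then have nc: "\<not> int p dvd c" and nd: "\<not> int p dvd d" using n by auto
  have "p mod 3 = 2" using p by (simp add: cong_def)
  then obtain k where k: "p = 3 * k + 2" by (metis div_mod_decomp mult.commute)
  have "c ^ 3 - d ^ 3 = (c - d) * (c * c + c * d + d * d)" by (simp add: power3_eq_cube algebra_simps)
  then have "[c ^ 3 = d ^ 3] (mod int p)" using dvd by (simp add: cong_iff_dvd_diff)
  then have c3: "[c ^ (3 * k) = d ^ (3 * k)] (mod int p)" by (simp add: power_mult cong_pow)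
  have fermat: "[x ^ (p - 1) = 1] (mod int p)" if "\<not> int p dvd x" for x
  proof -
    have x: "[x = int (nat (x mod int p))] (mod int p)"
      using p prime_gt_0_nat by (simp add: cong_def)
    then have "\<not> p dvd nat (x mod int p)"
      using that cong_dvd_iff[OF cong_sym] cong_dvd_iff by (metis cong_0_iff cong_trans int_dvd_int_iff)
    from fermat_theorem[OF p(1) this] have "[int (nat (x mod int p)) ^ (p - 1) = 1] (mod int p)"
      using cong_int_iff[of "nat (x mod int p) ^ (p - 1)" 1 p] by simp
    with cong_pow[OF x] show ?thesis by (rule cong_trans)
  qed
  have "[c ^ (3 * k) * c = d ^ (3 * k) * d] (mod int p)"
    using fermat[OF nc] fermat[OF nd] unfolding k by (simp add: cong_def mult.commute)
  moreover have "[d ^ (3 * k) * d = c ^ (3 * k) * d] (mod int p)"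
    using c3 by (intro cong_mult cong_refl) (rule cong_sym)
  ultimately have "[c ^ (3 * k) * c = c ^ (3 * k) * d] (mod int p)" by (rule cong_trans)
  then have "int p dvd c ^ (3 * k) * (c - d)" by (simp add: cong_iff_dvd_diff right_diff_distrib)
  then have "int p dvd c - d" using nc pp prime_dvd_mult_iff prime_dvd_power by blast
  then have "int p dvd (c * c + c * d + d * d) - (c - d) * (c + 2 * d)" using dvd by simp
  also have "\<dots> = 3 * (d * d)" by (simp add: algebra_simps)
  finally have "int p dvd 3" using nd pp prime_dvd_mult_iff by blast
  then have "p dvd 3" by (metis int_dvd_int_iff of_nat_numeral)
  then show False using p k by (auto dest: dvd_imp_le simp: cong_def)
qed

text \<open>The root is g^(phi(p^n)/3) for a g that is primitive modulo every power of p.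
  Primitivity modulo p itself makes u - 1 a unit, so that it can be cancelled from (u - 1)(u^2 + u +
  1); u \<noteq> 1 modulo p^n would not suffice for that.\<close>

lemma exists_cube_root_of_unity:
  fixes p n :: nat
  assumes p: "prime p" "[p = 1] (mod 3)" and n: "n \<ge> 1"
  obtains d :: int where "int (p ^ n) dvd d * d + d + 1"
proof -
  have "p mod 3 = 1" using p by (simp add: cong_def)
  then have p3: "\<not> 3 dvd p" and "p \<noteq> 2" by auto
  then have "odd p" using p primes_dvd_imp_eq two_is_prime_nat by blast
  with p obtain g where g: "\<And>k. k > 0 \<Longrightarrow> residue_primroot (p ^ k) g"
    using residue_primroot_odd_prime_power_exists by metis
  have "3 dvd p - 1" using p prime_gt_1_nat[of p] by (simp add: cong_def mod_eq_dvd_iff_nat[symmetric])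
  then obtain k where k: "p - 1 = 3 * k" by blast
  then have "k > 0" using p prime_gt_1_nat[of p] by (cases k) auto
  define u where "u = g ^ (p ^ (n - 1) * k)"
  have "ord (p ^ n) g = p ^ (n - 1) * (p - 1)"
    using g[of n] n p by (simp add: residue_primroot_def totient_prime_power)
  then have "[g ^ (p ^ (n - 1) * (p - 1)) = 1] (mod p ^ n)"
    by (metis ord)
  then have "[u ^ 3 = 1] (mod p ^ n)"
    unfolding k u_def power_mult[symmetric] by (simp add: mult_ac)
  then have "[int u ^ 3 = 1] (mod int (p ^ n))"
    using cong_int_iff[of "u ^ 3" 1 "p ^ n"] by simp
  then have "int (p ^ n) dvd int u ^ 3 - 1" by (simp add: cong_iff_dvd_diff)
  also have "int u ^ 3 - 1 = (int u - 1) * (int u * int u + int u + 1)"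
    by (simp add: power3_eq_cube algebra_simps)
  finally have dvd: "int (p ^ n) dvd (int u - 1) * (int u * int u + int u + 1)" .
  have "\<not> [u = 1] (mod p)"
  proof
    assume "[u = 1] (mod p)"
    then have "p - 1 dvd p ^ (n - 1) * k"
      using g[of 1] p unfolding u_def ord_divides by (simp add: residue_primroot_def totient_prime)
    then have "3 dvd p ^ (n - 1)" using \<open>k > 0\<close> unfolding k by simp
    then show False using p3 prime_dvd_power[of 3 p "n - 1"] by simp
  qed
  then have "\<not> int p dvd int u - 1"
    using cong_int_iff[of u 1 p] by (simp add: cong_iff_dvd_diff)
  then have "coprime (int (p ^ n)) (int u - 1)"
    using p by (simp add: prime_imp_coprime)
  then show thesis using dvd that coprime_dvd_mult_right_iff by blast
qed


section \<open>Consequences of the relations\<close>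

text \<open>The relations are stated in an arbitrary abelian group because they are used in three
  groups in turn: the mixed symbols, their \<Gamma>-coinvariants, and the quotient of the latter by
  the Manin image.\<close>

locale symbol_system = comm_group G for G (structure) +
  fixes s :: "int^2^2 \<Rightarrow> int^2^2 \<Rightarrow> 'a"
  assumes s_closed [simp]: "g \<in> carrier SL2Z \<Longrightarrow> h \<in> carrier SL2Z \<Longrightarrow> s g h \<in> carrier G"
    and s_cycle: "g \<in> carrier SL2Z \<Longrightarrow> h \<in> carrier SL2Z \<Longrightarrow> k \<in> carrier SL2Z \<Longrightarrow>
      s g h \<otimes> s h k \<otimes> s k g = \<one>"
    and s_minus_left: "g \<in> carrier SL2Z \<Longrightarrow> h \<in> carrier SL2Z \<Longrightarrow> s (- g) h = s g h"
    and s_minus_right: "g \<in> carrier SL2Z \<Longrightarrow> h \<in> carrier SL2Z \<Longrightarrow> s g (- h) = s g h"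
    and s_Tpow: "g \<in> carrier SL2Z \<Longrightarrow> s g (g ** matTpow m) = s g (g ** matT) [^] m"
begin

lemmas mem [simp, intro] = mult_in_SL2Z matS_in matT_in matTpow_in minus_in_SL2Z one_in_SL2Z

lemma s_refl [simp]: "g \<in> carrier SL2Z \<Longrightarrow> s g g = \<one>"
  using s_Tpow[of g 0] by simp

lemma s_trans:
  assumes "g \<in> carrier SL2Z" "h \<in> carrier SL2Z" "k \<in> carrier SL2Z"
  shows "s g h \<otimes> s h k = s g k"
proof -
  have "s g k \<otimes> s k g = \<one>" using s_cycle[of g g k] assms by simp
  then have "s g k = inv (s k g)" using assms by (simp add: inv_equality[symmetric])
  moreover have "s g h \<otimes> s h k = inv (s k g)"
    using s_cycle[OF assms] assms by (simp add: inv_equality[symmetric])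
  ultimately show ?thesis by simp
qed

text \<open>Translation by \<gamma> moves the path g, gV, gV^2, -g one step on, so its three steps
  have the same class. Their sum is {g, -g} = 0, and the class is 3-torsion.\<close>

lemma s_matV_eq_one:
  assumes tf: "torsion_free G" and g: "g \<in> carrier SL2Z"
    and inv: "\<And>h k. h \<in> carrier SL2Z \<Longrightarrow> k \<in> carrier SL2Z \<Longrightarrow> s (\<gamma> ** h) (\<gamma> ** k) = s h k"
    and \<gamma>: "\<gamma> ** g = g ** matV"
  shows "s g (g ** matV) = \<one>"
proof -
  let ?x = "s g (g ** matV)"
  have 2: "\<gamma> ** (g ** w) = g ** matV ** w" for w
    using \<gamma> by (simp add: matrix_mul_assoc)
  have "s (g ** matV) (g ** matV ** matV) = ?x"
    using inv[of g "g ** matV"] g unfolding 2 \<gamma> by simp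
  moreover have "s (g ** matV ** matV) (g ** matV ** matV ** matV) = ?x"
  proof -
    have "s (\<gamma> ** (g ** matV)) (\<gamma> ** (g ** (matV ** matV))) = s (g ** matV) (g ** (matV ** matV))"
      using g by (intro inv mem)
    moreover have "s (\<gamma> ** g) (\<gamma> ** (g ** matV)) = ?x" using g by (intro inv mem)
    ultimately show ?thesis unfolding 2 \<gamma> by (simp add: matrix_mul_assoc)
  qed
  moreover have "g ** matV ** matV ** matV = - g" by (simp add: mat2_eq_iff)
  ultimately have "?x \<otimes> ?x \<otimes> ?x = s g (- g)"
    using g s_trans[of g "g ** matV" "g ** matV ** matV"]
      s_trans[of g "g ** matV ** matV" "g ** matV ** matV ** matV"] by simp
  then have "?x [^] (3::nat) = \<one>"
    using g by (simp add: s_minus_right numeral_3_eq_3)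
  then have "?x \<in> torsion_subgroup G" using g by (auto simp: torsion_subgroup_def intro!: exI[of _ "3::nat"])
  then show ?thesis using tf by (simp add: torsion_free_def)
qed

end

section \<open>The quotient by the image of the Manin map\<close>

definition matL :: "int \<Rightarrow> int^2^2" where
  "matL m = vector [vector [1, 0], vector [m, 1]]"

text \<open>The order of this quotient is the index in question. Of \<Gamma> it remembers only two
  unipotent elements, which \<open>Gamma0\<close> and \<open>Gamma1\<close> of level N
  share.\<close>

locale manin_quotient = symbol_system +
  fixes N :: int
  assumes s_S: "g \<in> carrier SL2Z \<Longrightarrow> s g (g ** matS) = \<one>"
    and s_left_T: "g \<in> carrier SL2Z \<Longrightarrow> h \<in> carrier SL2Z \<Longrightarrow> s (matT ** g) (matT ** h) = s g h"
    and s_left_L: "g \<in> carrier SL2Z \<Longrightarrow> h \<in> carrier SL2Z \<Longrightarrow> s (matL N ** g) (matL N ** h) = s g h"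
    and odd_N: "odd N"
begin

definition \<beta> :: "int^2^2 \<Rightarrow> 'a" where "\<beta> g = s g (g ** matT)"

lemma \<beta>_closed [simp]: "g \<in> carrier SL2Z \<Longrightarrow> \<beta> g \<in> carrier G"
  by (simp add: \<beta>_def)

lemma \<beta>_minus: "g \<in> carrier SL2Z \<Longrightarrow> \<beta> (- g) = \<beta> g"
  by (simp add: \<beta>_def minus_matrix_mult s_minus_left s_minus_right)

text \<open>The relation {g, gT^2} = 2 {g, gT} reads b(g) + b(gT) = 2 b(g). With
  \<open>\<beta>_minus\<close> this makes b a function of the cusp g(oo).\<close>

lemma \<beta>_T: "g \<in> carrier SL2Z \<Longrightarrow> \<beta> (g ** matT) = \<beta> g"
proof -
  assume g: "g \<in> carrier SL2Z"
  have "g ** matT ** matT = g ** matTpow 2" by (simp add: mat2_eq_iff)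
  then have "\<beta> g \<otimes> \<beta> (g ** matT) = \<beta> g [^] (2::int)"
    using s_trans[of g "g ** matT" "g ** matT ** matT"] s_Tpow[OF g, of 2] g by (simp add: \<beta>_def)
  also have "\<beta> g [^] (2::int) = \<beta> g \<otimes> \<beta> g"
    using g int_pow_mult[of "\<beta> g" 1 1] by simp
  finally show ?thesis using g by simp
qed

lemma \<beta>_T_inv: "g \<in> carrier SL2Z \<Longrightarrow> \<beta> (g ** matTpow (- 1)) = \<beta> g"
  using \<beta>_T[of "g ** matTpow (- 1)"] by (simp add: matTpow_1[symmetric] mult_matTpow_add)

lemma \<beta>_triangle:
  assumes g: "g \<in> carrier SL2Z"
  shows "\<beta> g \<otimes> \<beta> (g ** matT ** matS) \<otimes> \<beta> (g ** matS) = \<one>"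
proof -
  have V: "s h (h ** matV) = \<beta> h" if h: "h \<in> carrier SL2Z" for h
    using s_trans[of h "h ** matT" "h ** matT ** matS"] s_S[of "h ** matT"] h
    by (simp add: \<beta>_def matrix_mul_assoc)
  have "g ** matV ** matV ** matV = - g" by (simp add: mat2_eq_iff)
  then have "\<beta> g \<otimes> \<beta> (g ** matV) \<otimes> \<beta> (g ** matV ** matV) = s g (- g)"
    using V[of g] V[of "g ** matV"] V[of "g ** matV ** matV"] g
      s_trans[of g "g ** matV" "g ** matV ** matV"]
      s_trans[of g "g ** matV ** matV" "g ** matV ** matV ** matV"] by simp
  moreover have "g ** matV ** matV ** matT = g ** matS" by (simp add: mat2_eq_iff)
  then have "\<beta> (g ** matV ** matV) = \<beta> (g ** matS)"
    using \<beta>_T[of "g ** matV ** matV"] g by simp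
  ultimately show ?thesis using g by (simp add: s_minus_right matrix_mul_assoc)
qed

text \<open>In terms of cusps, the triangles oo, 0, 1 and oo, 0, -1, moved by h, share two vertices,
  and b sums to 0 over each; hence b agrees at h(1) and h(-1). The claim is the case h = gT.\<close>

lemma \<beta>_TTS:
  assumes g: "g \<in> carrier SL2Z"
  shows "\<beta> (g ** matTpow 2 ** matS) = \<beta> (g ** matS)"
proof -
  have *: "\<beta> (h ** matT ** matS) = \<beta> (h ** matTpow (- 1) ** matS)" if h: "h \<in> carrier SL2Z" for h
  proof -
    have "\<beta> (h ** matS) \<otimes> \<beta> (h ** matS ** matT ** matS) \<otimes> \<beta> h = \<one>"
      using \<beta>_triangle[of "h ** matS"] h by (simp add: mult_matS_matS \<beta>_minus)
    then have "(\<beta> h \<otimes> \<beta> (h ** matS)) \<otimes> \<beta> (h ** matS ** matT ** matS) = (\<beta> h \<otimes> \<beta> (h ** matS)) \<otimes> \<beta> (h ** matT ** matS)"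
      using \<beta>_triangle[OF h] h by (simp add: m_ac)
    then have "\<beta> (h ** matS ** matT ** matS) = \<beta> (h ** matT ** matS)" using h by simp
    moreover have "h ** matS ** matT ** matS = h ** matTpow (- 1) ** matS ** matTpow (- 1)"
      by (simp add: mat2_eq_iff)
    ultimately show ?thesis using h by (simp add: \<beta>_minus \<beta>_T_inv)
  qed
  have "g ** matTpow 2 = g ** matT ** matT" "g ** matT ** matTpow (- 1) = g"
    by (simp_all add: mat2_eq_iff)
  then show ?thesis using *[of "g ** matT"] g by simp
qed

lemma \<beta>_even_S: "g \<in> carrier SL2Z \<Longrightarrow> \<beta> (g ** matTpow (2 * m) ** matS) = \<beta> (g ** matS)"
proof (induction m rule: int_induct[where k = 0])
  case (step1 i)
  then show ?case using \<beta>_TTS[of "g ** matTpow (2 * i)"]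
    by (simp add: mult_matTpow_add algebra_simps)
next
  case (step2 i)
  then show ?case using \<beta>_TTS[of "g ** matTpow (2 * (i - 1))"]
    by (simp add: mult_matTpow_add algebra_simps)
qed simp

lemma \<beta>_left_T: "g \<in> carrier SL2Z \<Longrightarrow> \<beta> (matT ** g) = \<beta> g"
  using s_left_T[of g "g ** matT"] by (simp add: \<beta>_def matrix_mul_assoc)

text \<open>A chain of cusps from oo to 0: \<open>matL N\<close> moves oo to 1/N, which is S(-N); as
  N is odd, an even shift of -N to 1 leads to S(1) = -1; finally T moves -1 to 0.\<close>

lemma \<beta>_S: "\<beta> matS = \<beta> (mat 1)"
proof -
  obtain k where k: "- N = 1 + 2 * k" using odd_N by (metis even_minus oddE add.commute)
  have "\<beta> (mat 1) = \<beta> (matL N)"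
    using s_left_L[of "mat 1" "matT"] by (simp add: \<beta>_def)
  also have "matL N = - (matS ** matT ** matTpow (2 * k) ** matS)"
  proof -
    have "matS ** matT ** matTpow (2 * k) = matS ** matTpow (- N)"
      unfolding k by (simp add: matTpow_1[symmetric] mult_matTpow_add)
    then show ?thesis by (simp add: mat2_eq_iff) (simp add: matS_def matL_def)
  qed
  also have "\<beta> \<dots> = \<beta> (matS ** matT ** matS)" by (simp add: \<beta>_minus \<beta>_even_S)
  also have "\<dots> = \<beta> (matT ** (matS ** matT ** matS))" by (simp add: \<beta>_left_T)
  also have "matT ** (matS ** matT ** matS) = matS ** matTpow (- 1)"
    by (simp add: mat2_eq_iff matrix_mul_assoc) (simp add: matS_def matT_def)
  also have "\<beta> \<dots> = \<beta> matS" by (simp add: \<beta>_minus \<beta>_T_inv)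
  finally show ?thesis by simp
qed

lemma \<beta>_cube: "\<beta> (mat 1) \<otimes> \<beta> (mat 1) \<otimes> \<beta> (mat 1) = \<one>"
  using \<beta>_triangle[of "mat 1"] \<beta>_left_T[of matS] by (simp add: \<beta>_S)

lemma \<beta>_constant: "g \<in> carrier SL2Z \<Longrightarrow> \<beta> g = \<beta> (mat 1)"
proof -
  have TS: "\<beta> (g ** matT ** matS) = \<beta> (mat 1)"
    if "g \<in> carrier SL2Z" "\<beta> g = \<beta> (mat 1)" "\<beta> (g ** matS) = \<beta> (mat 1)" for g
  proof -
    have "\<beta> (mat 1) \<otimes> \<beta> (mat 1) \<otimes> \<beta> (g ** matT ** matS) = \<beta> (mat 1) \<otimes> \<beta> (mat 1) \<otimes> \<beta> (mat 1)"
      using \<beta>_triangle[of g] that unfolding \<beta>_cube by (simp add: m_ac)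
    then show ?thesis using that by simp
  qed
  assume "g \<in> carrier SL2Z"
  \<comment> \<open>Both ends of the edge are carried along, because the triangle relation computes
    b(gTS) from b(g) and b(gS) together.\<close>
  then have "\<beta> g = \<beta> (mat 1) \<and> \<beta> (g ** matS) = \<beta> (mat 1)"
  proof (induction rule: SL2Z_induct)
    case one
    then show ?case by (simp add: \<beta>_S)
  next
    case (S g)
    then show ?case by (simp add: mult_matS_matS \<beta>_minus)
  next
    case (T g)
    then show ?case by (simp add: \<beta>_T TS)
  next
    case (T_inv g)
    have "g ** matTpow (- 1) ** matTpow 2 = g ** matT" by (simp add: mat2_eq_iff)
    then show ?case using T_inv \<beta>_TTS[of "g ** matTpow (- 1)"] by (simp add: \<beta>_T_inv TS)
  qed
  then show ?thesis by simp
qed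

text \<open>The elements are listed, possibly with repetitions, so that the index can be read off as
  the number of distinct ones.\<close>

lemma subgroup_generated_by_\<beta>:
  defines "b \<equiv> \<beta> (mat 1)"
  shows "subgroup {\<one>, b, b \<otimes> b} G"
proof -
  have b: "b \<in> carrier G" "b \<otimes> b \<otimes> b = \<one>" using \<beta>_cube by (simp_all add: b_def)
  have inv: "inv b = b \<otimes> b" "inv (b \<otimes> b) = b" using b by (simp_all add: inv_equality m_assoc)
  show ?thesis
  proof (rule subgroupI)
    fix x y assume "x \<in> {\<one>, b, b \<otimes> b}" "y \<in> {\<one>, b, b \<otimes> b}"
    moreover have "b \<otimes> (b \<otimes> b) = \<one>" "b \<otimes> (b \<otimes> (b \<otimes> b)) = b" using b by (simp_all flip: m_assoc)
    ultimately show "x \<otimes> y \<in> {\<one>, b, b \<otimes> b}" using b(1) by (auto simp: m_assoc)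
  qed (use b inv in auto)
qed

lemma s_in_subgroup:
  assumes g: "g \<in> carrier SL2Z" and h: "h \<in> carrier SL2Z"
  shows "s g h \<in> {\<one>, \<beta> (mat 1), \<beta> (mat 1) \<otimes> \<beta> (mat 1)}" (is "_ \<in> ?H")
proof -
  note H = subgroup_generated_by_\<beta>
  have 1: "s (mat 1) g \<in> ?H" if "g \<in> carrier SL2Z" for g
    using that
  proof (induction rule: SL2Z_induct)
    case one
    then show ?case by simp
  next
    case (S g)
    then show ?case using s_trans[of "mat 1" g "g ** matS"] s_S[of g] by simp
  next
    case (T g)
    have "s (mat 1) (g ** matT) = s (mat 1) g \<otimes> \<beta> (mat 1)"
      using s_trans[of "mat 1" g "g ** matT"] T \<beta>_constant[of g] by (simp add: \<beta>_def)
    then show ?case using subgroup.m_closed[OF H T.IH, of "\<beta> (mat 1)"] by simp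
  next
    case (T_inv g)
    have "s (mat 1) (g ** matTpow (- 1)) \<otimes> \<beta> (mat 1) = s (mat 1) g"
      using s_trans[of "mat 1" "g ** matTpow (- 1)" g] T_inv \<beta>_constant[of "g ** matTpow (- 1)"]
      by (simp add: \<beta>_def matTpow_1[symmetric] mult_matTpow_add)
    then have "s (mat 1) (g ** matTpow (- 1)) = s (mat 1) g \<otimes> inv (\<beta> (mat 1))"
      using T_inv by (metis inv_solve_right \<beta>_closed mem s_closed)
    then show ?case using subgroup.m_closed[OF H T_inv.IH subgroup.m_inv_closed[OF H, of "\<beta> (mat 1)"]] by simp
  qed
  have "s (mat 1) g \<otimes> s g h = s (mat 1) h" using g h by (simp add: s_trans)
  then have "s g h = inv (s (mat 1) g) \<otimes> s (mat 1) h"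
    using g h by (metis inv_solve_left mem s_closed)
  then show ?thesis
    using subgroup.m_closed[OF H subgroup.m_inv_closed[OF H 1[OF g]] 1[OF h]] by simp
qed

end


section \<open>The iterated quotients of the group of symbols\<close>

abbreviation symbol_sums :: "formal_symbols monoid" where
  "symbol_sums \<equiv> free_Abelian_group symbol_pairs"

definition mixed_class :: "formal_symbols \<Rightarrow> formal_symbols set set" where
  "mixed_class x = torsion_subgroup presented_symbols #>\<^bsub>presented_symbols\<^esub>
     (symbol_relation_subgroup #>\<^bsub>symbol_sums\<^esub> x)"

lemma mixed_symbol_eq_class: "mixed_symbol g h = mixed_class (frag_of (g, h))"
  by (simp add: mixed_symbol_def mixed_class_def)

lemma normal_symbol_relation_subgroup: "symbol_relation_subgroup \<lhd> symbol_sums"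
  by (simp add: comm_group.normal_iff_subgroup[OF abelian_free_Abelian_group] symbol_relation_subgroup)

lemma normal_torsion_presented: "torsion_subgroup presented_symbols \<lhd> presented_symbols"
  by (simp add: comm_group.normal_iff_subgroup comm_group.subgroup_torsion comm_group_presented_symbols)

lemma mixed_class_hom: "mixed_class \<in> hom symbol_sums mixed_symbols"
proof -
  have "(\<lambda>x. torsion_subgroup presented_symbols #>\<^bsub>presented_symbols\<^esub> x) \<circ>
      (\<lambda>x. symbol_relation_subgroup #>\<^bsub>symbol_sums\<^esub> x) \<in> hom symbol_sums mixed_symbols"
    unfolding mixed_symbols_def
    by (rule hom_compose[OF normal.r_coset_hom_Mod[OF normal_symbol_relation_subgroup]])
       (use normal.r_coset_hom_Mod[OF normal_torsion_presented] in \<open>simp add: presented_symbols_def\<close>)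
  then show ?thesis by (simp add: mixed_class_def[abs_def] comp_def)
qed

lemma mixed_class_surj: "mixed_class ` carrier symbol_sums = carrier mixed_symbols"
  by (simp only: mixed_class_def[abs_def] mixed_symbols_def presented_symbols_def carrier_FactGroup image_image)

lemma mixed_class_relation: "r \<in> symbol_relations \<Longrightarrow> mixed_class r = \<one>\<^bsub>mixed_symbols\<^esub>"
proof -
  assume "r \<in> symbol_relations"
  then have r: "r \<in> symbol_relation_subgroup"
    unfolding symbol_relation_subgroup_def by (rule generate.incl)
  have "symbol_relation_subgroup #>\<^bsub>symbol_sums\<^esub> r = \<one>\<^bsub>presented_symbols\<^esub>"
    using subgroup.rcos_const[OF symbol_relation_subgroup group_free_Abelian_group r]
    by (simp add: presented_symbols_def)
  then show ?thesis
    using subgroup.rcos_const[OF comm_group.subgroup_torsion[OF comm_group_presented_symbols] _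
        subgroup.one_closed[OF comm_group.subgroup_torsion[OF comm_group_presented_symbols]]]
      comm_group_presented_symbols
    by (simp add: mixed_class_def mixed_symbols_def comm_group_def)
qed

lemma symbol_sums_induct:
  assumes x: "x \<in> carrier symbol_sums" and h: "h \<in> hom symbol_sums G" and G: "group G"
    and H: "subgroup H G"
    and gen: "\<And>g g'. g \<in> carrier SL2Z \<Longrightarrow> g' \<in> carrier SL2Z \<Longrightarrow> h (frag_of (g, g')) \<in> H"
  shows "h x \<in> H"
proof -
  interpret group_hom symbol_sums G h
    using h G by (simp add: group_hom_def group_hom_axioms_def)
  have "x \<in> carrier symbol_sums \<and> h x \<in> H"
  proof (rule frag_induction[where S = symbol_pairs and c = x])
    show "Poly_Mapping.keys x \<subseteq> symbol_pairs" using x by simp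
    show "0 \<in> carrier symbol_sums \<and> h 0 \<in> H"
      using hom_one subgroup.one_closed[OF H] by simp
    show "frag_of a \<in> carrier symbol_sums \<and> h (frag_of a) \<in> H" if "a \<in> symbol_pairs" for a
      using that gen by auto
    fix a b assume ab: "a \<in> carrier symbol_sums \<and> h a \<in> H" "b \<in> carrier symbol_sums \<and> h b \<in> H"
    then have "a - b = a \<otimes>\<^bsub>symbol_sums\<^esub> inv\<^bsub>symbol_sums\<^esub> b" by simp
    moreover have "h (a \<otimes>\<^bsub>symbol_sums\<^esub> inv\<^bsub>symbol_sums\<^esub> b) \<in> H"
      using ab subgroup.m_closed[OF H _ subgroup.m_inv_closed[OF H]] by (simp only: hom_mult hom_inv G.inv_closed)
    ultimately show "a - b \<in> carrier symbol_sums \<and> h (a - b) \<in> H"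
      using ab G.m_closed[OF _ G.inv_closed] by metis
  qed
  then show ?thesis ..
qed

lemma mixed_symbols_generated:
  assumes H: "subgroup H mixed_symbols"
    and gen: "\<And>g g'. g \<in> carrier SL2Z \<Longrightarrow> g' \<in> carrier SL2Z \<Longrightarrow> mixed_symbol g g' \<in> H"
  shows "carrier mixed_symbols \<subseteq> H"
  unfolding mixed_class_surj[symmetric]
  using symbol_sums_induct[OF _ mixed_class_hom _ H] comm_group_mixed_symbols gen
  by (auto simp: mixed_symbol_eq_class comm_group_def)

text \<open>Allows an identity between two homomorphisms to be checked on generators, here for the
  invariance of a functional under \<Gamma>.\<close>

lemma subgroup_equalizer:
  assumes "f \<in> hom G K" "h \<in> hom G K" "group G" "group K"
  shows "subgroup {x \<in> carrier G. f x = h x} G"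
proof -
  interpret f: group_hom G K f using assms by (simp add: group_hom_def group_hom_axioms_def)
  interpret h: group_hom G K h using assms by (simp add: group_hom_def group_hom_axioms_def)
  show ?thesis
    by (rule f.G.subgroupI) auto
qed

lemma symbol_system_mixed_symbols: "symbol_system mixed_symbols mixed_symbol"
proof -
  interpret M: comm_group mixed_symbols by (rule comm_group_mixed_symbols)
  interpret p: group_hom symbol_sums mixed_symbols mixed_class
    using mixed_class_hom by (simp add: group_hom_def group_hom_axioms_def M.is_group)
  have diff: "mixed_class a = mixed_class b"
    if "a - b \<in> symbol_relations" "a \<in> carrier symbol_sums" "b \<in> carrier symbol_sums" for a b
  proof -
    have "mixed_class (a \<otimes>\<^bsub>symbol_sums\<^esub> inv\<^bsub>symbol_sums\<^esub> b) = \<one>\<^bsub>mixed_symbols\<^esub>"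
      using mixed_class_relation[OF that(1)] that by simp
    then have "mixed_class a \<otimes>\<^bsub>mixed_symbols\<^esub> inv\<^bsub>mixed_symbols\<^esub> mixed_class b = \<one>\<^bsub>mixed_symbols\<^esub>"
      using that by (simp only: p.hom_mult p.hom_inv p.G.inv_closed)
    then show ?thesis using that by (metis M.inv_solve_right' M.l_one p.hom_closed M.one_closed)
  qed
  have pm: "mixed_symbol (e1 ** g) (e2 ** h) = mixed_symbol g h"
    if "g \<in> carrier SL2Z" "h \<in> carrier SL2Z" "e1 \<in> {mat 1, - mat 1}" "e2 \<in> {mat 1, - mat 1}" for g h e1 e2
  proof -
    have "frag_of (g, h) - frag_of (e1 ** g, e2 ** h) \<in> symbol_relations"
      unfolding symbol_relations_def using that by blast
    moreover have "e1 ** g \<in> carrier SL2Z" "e2 ** h \<in> carrier SL2Z"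
      using that by (auto simp: minus_one_mult minus_in_SL2Z)
    ultimately show ?thesis
      unfolding mixed_symbol_eq_class using that by (intro diff[symmetric]) simp_all
  qed
  show ?thesis
  proof
    fix g h assume gh: "g \<in> carrier SL2Z" "h \<in> carrier SL2Z"
    then show "mixed_symbol g h \<in> carrier mixed_symbols" by (rule mixed_symbol_in)
    show "mixed_symbol (- g) h = mixed_symbol g h" "mixed_symbol g (- h) = mixed_symbol g h"
      using pm[of g h "- mat 1" "mat 1"] pm[of g h "mat 1" "- mat 1"] gh by (simp_all add: minus_one_mult)
    fix k assume k: "k \<in> carrier SL2Z"
    have "mixed_class (frag_of (g, h) \<otimes>\<^bsub>symbol_sums\<^esub> frag_of (h, k) \<otimes>\<^bsub>symbol_sums\<^esub> frag_of (k, g)) = \<one>\<^bsub>mixed_symbols\<^esub>"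
      using mixed_class_relation[of "frag_of (g, h) + frag_of (h, k) + frag_of (k, g)"] gh k
      unfolding symbol_relations_def by (simp only: mult_free_Abelian_group) blast
    moreover have "frag_of (g, h) \<in> carrier symbol_sums" "frag_of (h, k) \<in> carrier symbol_sums" "frag_of (k, g) \<in> carrier symbol_sums"
      using gh k by simp_all
    ultimately show "mixed_symbol g h \<otimes>\<^bsub>mixed_symbols\<^esub> mixed_symbol h k \<otimes>\<^bsub>mixed_symbols\<^esub> mixed_symbol k g = \<one>\<^bsub>mixed_symbols\<^esub>"
      unfolding mixed_symbol_eq_class by (simp only: p.hom_mult p.G.m_closed)
  next
    fix g and m :: int assume g: "g \<in> carrier SL2Z"
    have c: "frag_of (g, g ** matTpow m) \<in> carrier symbol_sums" "frag_of (g, g ** matT) \<in> carrier symbol_sums"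
      using g mult_in_SL2Z matTpow_in matT_in by simp_all
    have "mixed_class (frag_of (g, g ** matTpow m)) = mixed_class (frag_of (g, g ** matT) [^]\<^bsub>symbol_sums\<^esub> m)"
    proof (rule diff)
      show "frag_of (g, g ** matTpow m) - frag_of (g, g ** matT) [^]\<^bsub>symbol_sums\<^esub> m \<in> symbol_relations"
        using g unfolding int_pow_free_Abelian_group[OF c(2)[unfolded carrier_free_Abelian_group_iff]]
          symbol_relations_def matT_int_pow by blast
    qed (use c p.G.int_pow_closed in blast)+
    then show "mixed_symbol g (g ** matTpow m) = mixed_symbol g (g ** matT) [^]\<^bsub>mixed_symbols\<^esub> m"
      unfolding mixed_symbol_eq_class using c by (simp only: p.hom_int_pow)
  qed
qed

lemma symbol_system_hom:
  fixes G (structure)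
  assumes "symbol_system G s" and h: "h \<in> hom G K" and K: "comm_group K"
  shows "symbol_system K (\<lambda>g g'. h (s g g'))"
proof -
  interpret symbol_system G s by fact
  interpret K: comm_group K by fact
  interpret group_hom G K h using h by (simp add: group_hom_def group_hom_axioms_def K.is_group is_group)
  show ?thesis
  proof
    fix g g' g'' assume g: "g \<in> carrier SL2Z" "g' \<in> carrier SL2Z" "g'' \<in> carrier SL2Z"
    have "h (s g g' \<otimes> s g' g'' \<otimes> s g'' g) = \<one>\<^bsub>K\<^esub>" using s_cycle[OF g] by simp
    then show "h (s g g') \<otimes>\<^bsub>K\<^esub> h (s g' g'') \<otimes>\<^bsub>K\<^esub> h (s g'' g) = \<one>\<^bsub>K\<^esub>" using g by simp
  next
    fix g and m :: int assume g: "g \<in> carrier SL2Z"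
    then have "s g (g ** matT) \<in> carrier G" by simp
    then show "h (s g (g ** matTpow m)) = h (s g (g ** matT)) [^]\<^bsub>K\<^esub> m"
      unfolding s_Tpow[OF g] by (rule hom_int_pow)
  qed (simp_all add: s_minus_left s_minus_right)
qed


section \<open>Symbols modulo a fixed subgroup of SL2(Z)\<close>

context
  fixes \<Gamma> :: "(int^2^2) set"
  assumes \<Gamma>: "subgroup \<Gamma> SL2Z"
begin

lemma \<Gamma>_mem: "\<gamma> \<in> \<Gamma> \<Longrightarrow> \<gamma> \<in> carrier SL2Z"
  using \<Gamma> subgroup.subset by blast

lemma coinvariant_kernel_subgroup: "subgroup (coinvariant_kernel \<Gamma>) mixed_symbols"
  using coinvariant_kernel_in[OF subgroup.subset[OF \<Gamma>]] by (simp add: coinvariant_subgroups_def)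

lemma coinvariant_proj_hom:
  "(\<lambda>x. coinvariant_kernel \<Gamma> #>\<^bsub>mixed_symbols\<^esub> x) \<in> hom mixed_symbols (mixed_symbols_mod \<Gamma>)"
  unfolding mixed_symbols_mod_def
  by (intro normal.r_coset_hom_Mod)
     (simp add: comm_group.normal_iff_subgroup comm_group_mixed_symbols coinvariant_kernel_subgroup)

lemma symbol_system_mixed_symbols_mod: "symbol_system (mixed_symbols_mod \<Gamma>) (mixed_symbol_mod \<Gamma>)"
  using symbol_system_hom[OF symbol_system_mixed_symbols coinvariant_proj_hom
      comm_group_mixed_symbols_mod[OF subgroup.subset[OF \<Gamma>]]]
  by (simp add: mixed_symbol_mod_def[abs_def])

lemma torsion_free_mixed_symbols_mod: "torsion_free (mixed_symbols_mod \<Gamma>)"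
  using coinvariant_kernel_in[OF subgroup.subset[OF \<Gamma>]]
  by (simp add: coinvariant_subgroups_def mixed_symbols_mod_def)

lemma mixed_symbol_mod_left:
  assumes "\<gamma> \<in> \<Gamma>" "g \<in> carrier SL2Z" "h \<in> carrier SL2Z"
  shows "mixed_symbol_mod \<Gamma> (\<gamma> ** g) (\<gamma> ** h) = mixed_symbol_mod \<Gamma> g h"
  using coinvariant_kernel_in[OF subgroup.subset[OF \<Gamma>]] assms \<Gamma>_mem mixed_symbol_in
  by (simp add: mixed_symbol_mod_def coinvariant_subgroups_def flip: mixed_symbol_action_symbol)

text \<open>Differences of a potential satisfy the cocycle relation automatically, and the
  hypotheses on \<open>F\<close> cover sign, powers of T and \<Gamma>. As the target Z is
  torsion-free, the functional also kills all torsion that is divided out.\<close>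

lemma mixed_symbols_mod_hom_from_potential:
  fixes F :: "int^2^2 \<Rightarrow> int"
  assumes F_minus: "\<And>g. g \<in> carrier SL2Z \<Longrightarrow> F (- g) = F g"
    and F_Tpow: "\<And>g m. g \<in> carrier SL2Z \<Longrightarrow> F (g ** matTpow m) - F g = m * (F (g ** matT) - F g)"
    and F_left: "\<And>\<gamma> g h. \<gamma> \<in> \<Gamma> \<Longrightarrow> g \<in> carrier SL2Z \<Longrightarrow> h \<in> carrier SL2Z \<Longrightarrow>
      F (\<gamma> ** h) - F (\<gamma> ** g) = F h - F g"
  obtains \<phi> where "\<phi> \<in> hom (mixed_symbols_mod \<Gamma>) integer_group"
    "\<And>g h. g \<in> carrier SL2Z \<Longrightarrow> h \<in> carrier SL2Z \<Longrightarrow> \<phi> (mixed_symbol_mod \<Gamma> g h) = F h - F g"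
proof -
  interpret P: comm_group presented_symbols by (rule comm_group_presented_symbols)
  interpret M: comm_group mixed_symbols by (rule comm_group_mixed_symbols)
  obtain \<phi>0 where \<phi>0: "\<phi>0 \<in> hom symbol_sums integer_group"
      "\<And>g h. g \<in> carrier SL2Z \<Longrightarrow> h \<in> carrier SL2Z \<Longrightarrow> \<phi>0 (frag_of (g, h)) = F h - F g"
  proof -
    obtain \<phi>0 where 1: "\<phi>0 \<in> hom symbol_sums integer_group"
      and 2: "\<And>x. x \<in> symbol_pairs \<Longrightarrow> \<phi>0 (frag_of x) = F (snd x) - F (fst x)"
      by (rule comm_group.free_Abelian_group_universal[OF abelian_integer_group,
            of "\<lambda>x. F (snd x) - F (fst x)" symbol_pairs]) auto
    show thesis using that[OF 1] 2 by simp
  qed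
  interpret \<phi>0: group_hom symbol_sums integer_group \<phi>0
    using \<phi>0 by (simp add: group_hom_def group_hom_axioms_def)
  have "symbol_relations \<subseteq> kernel symbol_sums integer_group \<phi>0"
  proof
    fix r assume r: "r \<in> symbol_relations"
    have add: "\<phi>0 (a + b) = \<phi>0 a + \<phi>0 b" if "a \<in> carrier symbol_sums" "b \<in> carrier symbol_sums" for a b
      using \<phi>0.hom_mult[OF that] by simp
    have diff: "\<phi>0 (a - b) = \<phi>0 a - \<phi>0 b" if "a \<in> carrier symbol_sums" "b \<in> carrier symbol_sums" for a b
    proof -
      have "\<phi>0 (a \<otimes>\<^bsub>symbol_sums\<^esub> inv\<^bsub>symbol_sums\<^esub> b) = \<phi>0 a - \<phi>0 b"
        using that by (simp only: \<phi>0.hom_mult \<phi>0.hom_inv \<phi>0.G.inv_closed) simp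
      then show ?thesis using that by simp
    qed
    have cmul: "\<phi>0 (frag_cmul m a) = m * \<phi>0 a" if "a \<in> carrier symbol_sums" for a and m :: int
      using \<phi>0.hom_int_pow[OF that, of m] that by simp
    have fr: "frag_of (g, h) \<in> carrier symbol_sums" if "g \<in> carrier SL2Z" "h \<in> carrier SL2Z" for g h
      using that by simp
    note mem = mult_in_SL2Z matS_in matT_in matTpow_in minus_in_SL2Z
    consider (1) a b c where "r = frag_of (a, b) + frag_of (b, c) + frag_of (c, a)"
        "a \<in> carrier SL2Z" "b \<in> carrier SL2Z" "c \<in> carrier SL2Z"
      | (2) a b e1 e2 where "r = frag_of (a, b) - frag_of (e1 ** a, e2 ** b)"
        "a \<in> carrier SL2Z" "b \<in> carrier SL2Z" "e1 \<in> {mat 1, - mat 1}" "e2 \<in> {mat 1, - mat 1}"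
      | (3) a and m :: int where
        "r = frag_of (a, a ** matTpow m) - frag_cmul m (frag_of (a, a ** matT))" "a \<in> carrier SL2Z"
      using r unfolding symbol_relations_def matT_int_pow by blast
    then have "\<phi>0 r = 0"
    proof cases
      case 1
      have "\<phi>0 r = (F b - F a) + (F c - F b) + (F a - F c)"
        unfolding 1(1) using 1(2-) fr \<phi>0.G.m_closed by (simp only: add \<phi>0(2) mult_free_Abelian_group)
      then show ?thesis by simp
    next
      case 2
      have e: "e1 ** a \<in> carrier SL2Z" "e2 ** b \<in> carrier SL2Z"
        using 2 by (auto simp: minus_one_mult mem)
      have "F (e1 ** a) = F a" "F (e2 ** b) = F b"
        using 2 F_minus by (auto simp: minus_one_mult)
      then show ?thesis unfolding 2(1) using 2 e by (simp only: diff fr \<phi>0(2))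
    next
      case 3
      have "frag_cmul m (frag_of (a, a ** matT)) \<in> carrier symbol_sums"
        using 3 keys_cmul[of m "frag_of (a, a ** matT)"] mem by (auto split: if_splits)
      then have "\<phi>0 r = \<phi>0 (frag_of (a, a ** matTpow m)) - \<phi>0 (frag_cmul m (frag_of (a, a ** matT)))"
        unfolding 3(1) by (intro diff fr mem 3)
      also have "\<dots> = (F (a ** matTpow m) - F a) - m * (F (a ** matT) - F a)"
        by (subst cmul) (simp_all only: fr \<phi>0(2) mem 3)
      finally show ?thesis using F_Tpow[OF 3(2)] by simp
    qed
    then show "r \<in> kernel symbol_sums integer_group \<phi>0"
      using subsetD[OF symbol_relations_in r] unfolding kernel_def by simp
  qed
  then have "symbol_relation_subgroup \<subseteq> kernel symbol_sums integer_group \<phi>0"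
    unfolding symbol_relation_subgroup_def
    by (intro \<phi>0.G.generate_subgroup_incl \<phi>0.subgroup_kernel)
  then obtain \<phi>1 where \<phi>1: "\<phi>1 \<in> hom presented_symbols integer_group"
      "\<And>x. x \<in> carrier symbol_sums \<Longrightarrow> \<phi>1 (symbol_relation_subgroup #>\<^bsub>symbol_sums\<^esub> x) = \<phi>0 x"
    using \<phi>0.FactGroup_universal_kernel[OF normal_symbol_relation_subgroup]
    unfolding presented_symbols_def by metis
  interpret \<phi>1: group_hom presented_symbols integer_group \<phi>1
    using \<phi>1 by (simp add: group_hom_def group_hom_axioms_def P.is_group)
  have "torsion_subgroup presented_symbols \<subseteq> kernel presented_symbols integer_group \<phi>1"
  proof
    fix x assume "x \<in> torsion_subgroup presented_symbols"
    then obtain k :: nat where x: "x \<in> carrier presented_symbols" and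
      k: "k > 0" "x [^]\<^bsub>presented_symbols\<^esub> k = \<one>\<^bsub>presented_symbols\<^esub>"
      by (auto simp: torsion_subgroup_def)
    have "int k * \<phi>1 x = 0" using \<phi>1.hom_nat_pow[OF x, of k] k(2) by simp
    then show "x \<in> kernel presented_symbols integer_group \<phi>1" using x k(1) by (simp add: kernel_def)
  qed
  then obtain \<phi>2 where \<phi>2: "\<phi>2 \<in> hom mixed_symbols integer_group"
      "\<And>x. x \<in> carrier presented_symbols \<Longrightarrow>
        \<phi>2 (torsion_subgroup presented_symbols #>\<^bsub>presented_symbols\<^esub> x) = \<phi>1 x"
    using \<phi>1.FactGroup_universal_kernel[OF normal_torsion_presented]
    unfolding mixed_symbols_def by metis
  interpret \<phi>2: group_hom mixed_symbols integer_group \<phi>2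
    using \<phi>2 by (simp add: group_hom_def group_hom_axioms_def M.is_group)
  have \<phi>2_symbol: "\<phi>2 (mixed_symbol g h) = F h - F g" if "g \<in> carrier SL2Z" "h \<in> carrier SL2Z" for g h
  proof -
    have 1: "frag_of (g, h) \<in> carrier symbol_sums" using that by simp
    then have 2: "symbol_relation_subgroup #>\<^bsub>symbol_sums\<^esub> frag_of (g, h) \<in> carrier presented_symbols"
      unfolding presented_symbols_def carrier_FactGroup by (rule imageI)
    show ?thesis unfolding mixed_symbol_def \<phi>2(2)[OF 2] \<phi>1(2)[OF 1] using that by (rule \<phi>0(2))
  qed
  \<comment> \<open>The quotient by this kernel embeds into Z and has trivial \<Gamma>-action, so
    the kernel is one of the subgroups intersected in \<open>coinvariant_kernel\<close>.\<close>
  let ?N = "kernel mixed_symbols integer_group \<phi>2"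
  have "?N \<in> coinvariant_subgroups \<Gamma>"
    unfolding coinvariant_subgroups_def
  proof (intro CollectI conjI ballI)
    show N: "subgroup ?N mixed_symbols" by (rule \<phi>2.subgroup_kernel)
    show "torsion_free (mixed_symbols Mod ?N)"
      unfolding M.torsion_free_Mod_iff[OF N] by (auto simp: kernel_def \<phi>2.hom_nat_pow)
    fix \<gamma> x assume \<gamma>: "\<gamma> \<in> \<Gamma>" and x: "x \<in> carrier mixed_symbols"
    have act: "mixed_symbol_action \<gamma> \<in> hom mixed_symbols mixed_symbols"
      using mixed_symbol_action_iso[OF \<Gamma>_mem[OF \<gamma>]] by (simp add: iso_def)
    have "carrier mixed_symbols \<subseteq> {x \<in> carrier mixed_symbols. (\<phi>2 \<circ> mixed_symbol_action \<gamma>) x = \<phi>2 x}"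
      by (intro mixed_symbols_generated subgroup_equalizer[OF hom_compose[OF act \<phi>2(1)] \<phi>2(1)])
         (simp_all add: M.is_group mixed_symbol_in mixed_symbol_action_symbol \<phi>2_symbol mult_in_SL2Z
           \<Gamma>_mem[OF \<gamma>] F_left[OF \<gamma>])
    then have eq: "\<phi>2 (mixed_symbol_action \<gamma> x) = \<phi>2 x" using x by auto
    have ax: "mixed_symbol_action \<gamma> x \<in> carrier mixed_symbols" using act x by (auto simp: hom_def)
    then have "mixed_symbol_action \<gamma> x \<otimes>\<^bsub>mixed_symbols\<^esub> inv\<^bsub>mixed_symbols\<^esub> x \<in> ?N"
      using x eq by (simp add: kernel_def)
    then have "mixed_symbol_action \<gamma> x \<in> ?N #>\<^bsub>mixed_symbols\<^esub> x"
      using subgroup.rcos_module[OF N M.is_group x ax] by simp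
    then show "?N #>\<^bsub>mixed_symbols\<^esub> mixed_symbol_action \<gamma> x = ?N #>\<^bsub>mixed_symbols\<^esub> x"
      using M.repr_independence[OF _ x N] by simp
  qed
  then have "coinvariant_kernel \<Gamma> \<subseteq> ?N" unfolding coinvariant_kernel_def by blast
  then obtain \<phi> where \<phi>: "\<phi> \<in> hom (mixed_symbols_mod \<Gamma>) integer_group"
      "\<And>x. x \<in> carrier mixed_symbols \<Longrightarrow> \<phi> (coinvariant_kernel \<Gamma> #>\<^bsub>mixed_symbols\<^esub> x) = \<phi>2 x"
    using \<phi>2.FactGroup_universal_kernel[of "coinvariant_kernel \<Gamma>"] coinvariant_kernel_subgroup
    unfolding mixed_symbols_mod_def by (metis M.normal_iff_subgroup)
  show thesis
    by (rule that[OF \<phi>(1)]) (simp add: mixed_symbol_mod_def \<phi>(2) mixed_symbol_in \<phi>2_symbol)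
qed

section \<open>The index of the image of the Manin map\<close>

lemma manin_image_subgroup: "subgroup (manin_image \<Gamma>) (mixed_symbols_mod \<Gamma>)"
proof -
  interpret group_hom "free_Abelian_group (PSL2Z_cosets \<Gamma>)" "mixed_symbols_mod \<Gamma>" "manin_map \<Gamma>"
    using manin_map_hom[OF \<Gamma>] comm_group_mixed_symbols_mod[OF subgroup.subset[OF \<Gamma>]]
    by (simp add: group_hom_def group_hom_axioms_def comm_group_def)
  show ?thesis unfolding manin_image_def by (rule img_is_subgroup)
qed

lemma manin_symbol_in_image:
  assumes "g \<in> carrier SL2Z"
  shows "mixed_symbol_mod \<Gamma> g (g ** matS) \<in> manin_image \<Gamma>"
  unfolding manin_image_def manin_map_coset[OF \<Gamma> assms, symmetric]
  using assms by (intro imageI) (simp add: PSL2Z_cosets_eq)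

lemma hom_manin_image_dvd:
  assumes \<phi>: "\<phi> \<in> hom (mixed_symbols_mod \<Gamma>) integer_group"
    and dvd: "\<And>g. g \<in> carrier SL2Z \<Longrightarrow> k dvd \<phi> (mixed_symbol_mod \<Gamma> g (g ** matS))"
    and x: "x \<in> manin_image \<Gamma>"
  shows "k dvd \<phi> x"
proof -
  let ?F = "free_Abelian_group (PSL2Z_cosets \<Gamma>)"
  interpret group_hom ?F integer_group "\<phi> \<circ> manin_map \<Gamma>"
    using hom_compose[OF manin_map_hom[OF \<Gamma>] \<phi>] by (simp add: group_hom_def group_hom_axioms_def)
  obtain y where y: "y \<in> carrier ?F" "x = manin_map \<Gamma> y"
    using x unfolding manin_image_def by blast
  have "y \<in> carrier ?F \<and> k dvd (\<phi> \<circ> manin_map \<Gamma>) y"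
  proof (rule frag_induction[where S = "PSL2Z_cosets \<Gamma>" and c = y])
    show "Poly_Mapping.keys y \<subseteq> PSL2Z_cosets \<Gamma>" using y by simp
    show "0 \<in> carrier ?F \<and> k dvd (\<phi> \<circ> manin_map \<Gamma>) 0" using hom_one by simp
    show "frag_of c \<in> carrier ?F \<and> k dvd (\<phi> \<circ> manin_map \<Gamma>) (frag_of c)" if "c \<in> PSL2Z_cosets \<Gamma>" for c
      using that dvd by (auto simp: PSL2Z_cosets_eq manin_map_coset[OF \<Gamma>])
    fix a b assume ab: "a \<in> carrier ?F \<and> k dvd (\<phi> \<circ> manin_map \<Gamma>) a" "b \<in> carrier ?F \<and> k dvd (\<phi> \<circ> manin_map \<Gamma>) b"
    have "(\<phi> \<circ> manin_map \<Gamma>) (a \<otimes>\<^bsub>?F\<^esub> inv\<^bsub>?F\<^esub> b) = (\<phi> \<circ> manin_map \<Gamma>) a - (\<phi> \<circ> manin_map \<Gamma>) b"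
      using ab by (simp only: hom_mult hom_inv G.inv_closed) simp
    moreover have "a \<otimes>\<^bsub>?F\<^esub> inv\<^bsub>?F\<^esub> b \<in> carrier ?F" using ab G.m_closed[OF _ G.inv_closed] by blast
    moreover have "a - b = a \<otimes>\<^bsub>?F\<^esub> inv\<^bsub>?F\<^esub> b" using ab by simp
    ultimately show "a - b \<in> carrier ?F \<and> k dvd (\<phi> \<circ> manin_map \<Gamma>) (a - b)"
      using ab dvd_diff by metis
  qed
  then show ?thesis by (simp add: y)
qed

text \<open>Modulo the image every symbol is 1, b or b^2 with b^3 = 1. The last claim allows any g:
  a coset fixed by V gives information on b at that g alone, and constancy of b transports it to the
  identity.\<close>

lemma manin_index:
  fixes N :: int
  assumes T: "matT \<in> \<Gamma>" and L: "matL N \<in> \<Gamma>" and N: "odd N"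
  defines "index \<equiv> card (rcosets\<^bsub>mixed_symbols_mod \<Gamma>\<^esub> (manin_image \<Gamma>))"
  shows "finite (rcosets\<^bsub>mixed_symbols_mod \<Gamma>\<^esub> (manin_image \<Gamma>))"
    and "index = 1 \<or> index = 3"
    and "index = 1 \<longleftrightarrow> mixed_symbol_mod \<Gamma> (mat 1) matT \<in> manin_image \<Gamma>"
    and "g \<in> carrier SL2Z \<Longrightarrow> mixed_symbol_mod \<Gamma> g (g ** matT) \<in> manin_image \<Gamma> \<Longrightarrow> index = 1"
proof -
  let ?M = "mixed_symbols_mod \<Gamma>" and ?I = "manin_image \<Gamma>"
  let ?Q = "?M Mod ?I"
  interpret M: symbol_system ?M "mixed_symbol_mod \<Gamma>" by (rule symbol_system_mixed_symbols_mod)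
  have I: "?I \<lhd> ?M" by (simp add: M.normal_iff_subgroup manin_image_subgroup)
  have proj: "(\<lambda>x. ?I #>\<^bsub>?M\<^esub> x) \<in> hom ?M ?Q" by (rule normal.r_coset_hom_Mod[OF I])
  have Qc: "comm_group ?Q" by (rule M.abelian_FactGroup[OF manin_image_subgroup])
  have I_iff: "?I #>\<^bsub>?M\<^esub> x = ?I \<longleftrightarrow> x \<in> ?I" if "x \<in> carrier ?M" for x
    using that M.coset_join1[OF _ that manin_image_subgroup] M.coset_join2[OF that manin_image_subgroup]
      subgroup.subset[OF manin_image_subgroup] by blast
  interpret Q: manin_quotient ?Q "\<lambda>g h. ?I #>\<^bsub>?M\<^esub> mixed_symbol_mod \<Gamma> g h" N
  proof (intro manin_quotient.intro symbol_system_hom[OF symbol_system_mixed_symbols_mod proj Qc])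
    show "manin_quotient_axioms ?Q (\<lambda>g h. ?I #>\<^bsub>?M\<^esub> mixed_symbol_mod \<Gamma> g h) N"
    proof
      fix g assume g: "g \<in> carrier SL2Z"
      then show "?I #>\<^bsub>?M\<^esub> mixed_symbol_mod \<Gamma> g (g ** matS) = \<one>\<^bsub>?Q\<^esub>"
        using I_iff[of "mixed_symbol_mod \<Gamma> g (g ** matS)"] manin_symbol_in_image[OF g] by simp
    qed (simp_all add: mixed_symbol_mod_left T L N)
  qed
  define b where "b = Q.\<beta> (mat 1)"
  have b: "b = ?I #>\<^bsub>?M\<^esub> mixed_symbol_mod \<Gamma> (mat 1) matT" by (simp add: b_def Q.\<beta>_def)
  have bQ: "b \<in> carrier ?Q" unfolding b_def by (intro Q.\<beta>_closed one_in_SL2Z)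
  let ?H = "{\<one>\<^bsub>?Q\<^esub>, b, b \<otimes>\<^bsub>?Q\<^esub> b}"
  have H: "subgroup ?H ?Q" unfolding b_def by (rule Q.subgroup_generated_by_\<beta>)
  have carrier: "carrier ?Q = ?H"
  proof
    show "?H \<subseteq> carrier ?Q" by (rule subgroup.subset[OF H])
    \<comment> \<open>The composite of all projections maps formal sums onto the quotient, so only
      single symbols have to be examined.\<close>
    define h where "h = (\<lambda>x. ?I #>\<^bsub>?M\<^esub> x) \<circ>
      (\<lambda>x. coinvariant_kernel \<Gamma> #>\<^bsub>mixed_symbols\<^esub> x) \<circ> mixed_class"
    have h: "h \<in> hom symbol_sums ?Q"
      unfolding h_def by (intro hom_compose[OF mixed_class_hom] hom_compose[OF coinvariant_proj_hom] proj)
    have surj: "carrier ?Q = h ` carrier symbol_sums"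
      unfolding h_def image_comp[symmetric] mixed_class_surj
      by (simp only: mixed_symbols_mod_def carrier_FactGroup)
    have gen: "h (frag_of (g, g')) \<in> ?H" if "g \<in> carrier SL2Z" "g' \<in> carrier SL2Z" for g g'
      using Q.s_in_subgroup[OF that] unfolding b_def h_def
      by (simp only: o_apply mixed_symbol_eq_class[symmetric] mixed_symbol_mod_def[symmetric])
    show "carrier ?Q \<subseteq> ?H"
    proof
      fix x assume "x \<in> carrier ?Q"
      then obtain y where y: "y \<in> carrier symbol_sums" "x = h y" unfolding surj by (rule imageE)
      show "x \<in> ?H" unfolding y(2) by (rule symbol_sums_induct[OF y(1) h Q.is_group H gen])
    qed
  qed
  have rc: "rcosets\<^bsub>?M\<^esub> ?I = ?H" using carrier by (simp add: FactGroup_def)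
  show "finite (rcosets\<^bsub>?M\<^esub> ?I)" unfolding rc by simp
  have cube: "b \<otimes>\<^bsub>?Q\<^esub> b \<otimes>\<^bsub>?Q\<^esub> b = \<one>\<^bsub>?Q\<^esub>" unfolding b_def by (rule Q.\<beta>_cube)
  have card: "index = (if b = \<one>\<^bsub>?Q\<^esub> then 1 else 3)"
  proof (cases "b = \<one>\<^bsub>?Q\<^esub>")
    case True
    have H1: "?H = {\<one>\<^bsub>?Q\<^esub>}" unfolding True Q.r_one[OF Q.one_closed] by (rule trans[OF insert_absorb2 insert_absorb2])
    have "card {x} = 1" for x :: "formal_symbols set set set set" by simp
    then show ?thesis unfolding index_def rc H1 if_P[OF True] .
  next
    case False
    then have "b \<otimes>\<^bsub>?Q\<^esub> b \<noteq> b" using Q.r_cancel_one[OF bQ bQ] by blast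
    moreover have "b \<otimes>\<^bsub>?Q\<^esub> b \<noteq> \<one>\<^bsub>?Q\<^esub>" using cube False Q.l_one[OF bQ] by metis
    moreover have "card {x, y, z} = 3" if "y \<noteq> x" "z \<noteq> y" "z \<noteq> x" for x y z :: "formal_symbols set set set set"
      using that by auto
    ultimately show ?thesis unfolding index_def rc if_not_P[OF False] using False by blast
  qed
  then show "index = 1 \<or> index = 3" by simp
  show "index = 1 \<longleftrightarrow> mixed_symbol_mod \<Gamma> (mat 1) matT \<in> ?I"
    using I_iff[of "mixed_symbol_mod \<Gamma> (mat 1) matT"] card one_in_SL2Z matT_in
    by (simp add: b)
  show "index = 1" if g: "g \<in> carrier SL2Z" and "mixed_symbol_mod \<Gamma> g (g ** matT) \<in> ?I"
  proof -
    have "?I #>\<^bsub>?M\<^esub> mixed_symbol_mod \<Gamma> g (g ** matT) = \<one>\<^bsub>?Q\<^esub>"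
      using I_iff[of "mixed_symbol_mod \<Gamma> g (g ** matT)"] that by simp
    then have "b = \<one>\<^bsub>?Q\<^esub>" using Q.\<beta>_constant[OF g] by (simp add: b_def Q.\<beta>_def)
    then show ?thesis using card by simp
  qed
qed

text \<open>Since {g, gV} = {g, gT} + {gT, gTS} vanishes, {g, gT} is the inverse of a Manin
  symbol.\<close>

lemma manin_index_eq_1:
  fixes N :: int
  assumes T: "matT \<in> \<Gamma>" and L: "matL N \<in> \<Gamma>" and N: "odd N"
    and g: "g \<in> carrier SL2Z" and \<gamma>: "\<gamma> \<in> \<Gamma>" "\<gamma> ** g = g ** matV"
  shows "card (rcosets\<^bsub>mixed_symbols_mod \<Gamma>\<^esub> (manin_image \<Gamma>)) = 1"
proof (rule manin_index(4)[OF T L N g])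
  interpret M: symbol_system "mixed_symbols_mod \<Gamma>" "mixed_symbol_mod \<Gamma>"
    by (rule symbol_system_mixed_symbols_mod)
  let ?x = "mixed_symbol_mod \<Gamma> g (g ** matT)"
  let ?y = "mixed_symbol_mod \<Gamma> (g ** matT) (g ** matT ** matS)"
  have xy: "?x \<in> carrier (mixed_symbols_mod \<Gamma>)" "?y \<in> carrier (mixed_symbols_mod \<Gamma>)" using g by simp_all
  have "mixed_symbol_mod \<Gamma> g (g ** matV) = \<one>\<^bsub>mixed_symbols_mod \<Gamma>\<^esub>"
    by (rule M.s_matV_eq_one[OF torsion_free_mixed_symbols_mod g mixed_symbol_mod_left[OF \<gamma>(1)] \<gamma>(2)])
  then have "?x \<otimes>\<^bsub>mixed_symbols_mod \<Gamma>\<^esub> ?y = \<one>\<^bsub>mixed_symbols_mod \<Gamma>\<^esub>"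
    using M.s_trans[of g "g ** matT" "g ** matT ** matS"] g by (simp add: matrix_mul_assoc)
  then have "?x = inv\<^bsub>mixed_symbols_mod \<Gamma>\<^esub> ?y" using M.inv_equality xy by metis
  then show "?x \<in> manin_image \<Gamma>"
    using subgroup.m_inv_closed[OF manin_image_subgroup manin_symbol_in_image[of "g ** matT"]] g by simp
qed

text \<open>Index 1 would put {1, T} into the image and so make B(1), its value under the
  homomorphism, divisible by 3.\<close>

lemma manin_index_neq_1:
  fixes N :: int
  assumes T: "matT \<in> \<Gamma>" and L: "matL N \<in> \<Gamma>" and N: "odd N"
    and fin: "finite (pm_coset \<Gamma> ` carrier SL2Z)"
    and no_fix: "\<And>g. g \<in> carrier SL2Z \<Longrightarrow> pm_coset \<Gamma> (g ** matV) \<noteq> pm_coset \<Gamma> g"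
  shows "card (rcosets\<^bsub>mixed_symbols_mod \<Gamma>\<^esub> (manin_image \<Gamma>)) \<noteq> 1"
proof
  assume "card (rcosets\<^bsub>mixed_symbols_mod \<Gamma>\<^esub> (manin_image \<Gamma>)) = 1"
  then have in_image: "mixed_symbol_mod \<Gamma> (mat 1) matT \<in> manin_image \<Gamma>"
    using manin_index(3)[OF T L N] by simp
  obtain A B where "edge_cocycle A B"
    and inv: "\<And>\<gamma> g. \<gamma> \<in> \<Gamma> \<Longrightarrow> A (\<gamma> ** g) = A g" "\<And>\<gamma> g. \<gamma> \<in> \<Gamma> \<Longrightarrow> B (\<gamma> ** g) = B g"
    and A3: "\<And>g. 3 dvd A g" and B3: "\<not> 3 dvd B (mat 1)"
    using exists_edge_cocycle[OF \<Gamma> fin T no_fix] by blast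
  interpret edge_cocycle A B by fact
  have eq: "F (\<gamma> ** h) - F (\<gamma> ** g) = F h - F g"
    if "\<gamma> \<in> \<Gamma>" "g \<in> carrier SL2Z" "h \<in> carrier SL2Z" for \<gamma> g h
    using F_equivariant[OF \<Gamma>_mem[OF that(1)] inv[OF that(1)] that(2)]
      F_equivariant[OF \<Gamma>_mem[OF that(1)] inv[OF that(1)] that(3)] by simp
  obtain \<phi> where \<phi>: "\<phi> \<in> hom (mixed_symbols_mod \<Gamma>) integer_group"
    "\<And>g h. g \<in> carrier SL2Z \<Longrightarrow> h \<in> carrier SL2Z \<Longrightarrow> \<phi> (mixed_symbol_mod \<Gamma> g h) = F h - F g"
    using mixed_symbols_mod_hom_from_potential[of F] F_minus F_Tpow F_T eq
    by (metis (no_types, lifting) add_diff_cancel_left')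
  have "3 dvd \<phi> (mixed_symbol_mod \<Gamma> g (g ** matS))" if "g \<in> carrier SL2Z" for g
    using that A3 by (simp add: \<phi>(2) F_S mult_in_SL2Z matS_in)
  from hom_manin_image_dvd[OF \<phi>(1) this in_image]
  have "3 dvd F (mat 1 ** matT) - F (mat 1)" by (simp add: \<phi>(2) one_in_SL2Z matT_in)
  then show False using B3 F_T[OF one_in_SL2Z] by simp
qed

end

lemma odd_prime_power: "odd (int (p ^ n))" if "prime p" "p \<ge> 5" for p n :: nat
  using that primes_dvd_imp_eq[of 2 p] two_is_prime_nat by (auto simp: prime_dvd_power_iff)

theorem theorem1p2:
  fixes p n :: nat and \<Gamma> :: "(int^2^2) set"
  assumes "prime p" and "p \<ge> 5" and "n \<ge> 1"
    and "\<Gamma> = Gamma1 (p ^ n) \<or> \<Gamma> = Gamma0 (p ^ n)"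
  shows "finite (rcosets\<^bsub>mixed_symbols_mod \<Gamma>\<^esub> (manin_image \<Gamma>))
    \<and> card (rcosets\<^bsub>mixed_symbols_mod \<Gamma>\<^esub> (manin_image \<Gamma>)) dvd 3
    \<and> (card (rcosets\<^bsub>mixed_symbols_mod \<Gamma>\<^esub> (manin_image \<Gamma>)) = 1
         \<longleftrightarrow> [p = 1] (mod 3) \<and> \<Gamma> = Gamma0 (p ^ n))"
proof -
  let ?N = "int (p ^ n)"
  have sub: "Gamma1 (p ^ n) \<subseteq> \<Gamma>" "\<Gamma> \<subseteq> Gamma0 (p ^ n)"
    using assms(4) by (auto simp: Gamma0_def Gamma1_def)
  have \<Gamma>: "subgroup \<Gamma> SL2Z" using assms(4) subgroup_Gamma0 subgroup_Gamma1 by blast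
  have T: "matT \<in> \<Gamma>"
    using sub(1) matT_in by (auto simp: Gamma1_def matT_def)
  have L: "matL ?N \<in> \<Gamma>"
    using sub(1) by (auto simp: Gamma1_def matL_def SL2Z_iff cong_0_iff)
  have N: "odd ?N" using assms(1,2) by (rule odd_prime_power)
  note index = manin_index[OF \<Gamma> T L N]
  have p_dvd: "int p dvd ?N" using assms(3) by (simp add: dvd_power)
  have "card (rcosets\<^bsub>mixed_symbols_mod \<Gamma>\<^esub> (manin_image \<Gamma>)) = 1"
    if p3: "[p = 1] (mod 3)" and eq: "\<Gamma> = Gamma0 (p ^ n)"
  proof -
    obtain d where d: "?N dvd d * d + d + 1"
      using exists_cube_root_of_unity[OF assms(1) p3 assms(3)] by blast
    \<comment> \<open>The bottom row (1, d) makes d^2 + d + 1 the lower left entry of g V g^(-1),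
      and \<open>?\<gamma>\<close> is this conjugate.\<close>
    let ?g = "vector [vector [0, - 1], vector [1, d]] :: int^2^2"
    let ?\<gamma> = "vector [vector [- d, - 1], vector [d * d + d + 1, d + 1]] :: int^2^2"
    show ?thesis
    proof (rule manin_index_eq_1[OF \<Gamma> T L N])
      show "?g \<in> carrier SL2Z" by (simp add: SL2Z_iff)
      show "?\<gamma> \<in> \<Gamma>"
        using d unfolding eq Gamma0_def mem_Collect_eq cong_0_iff
        by (simp add: SL2Z_iff algebra_simps)
      show "?\<gamma> ** ?g = ?g ** matV"
        by (simp add: mat2_eq_iff) (simp add: matrix_matrix_mult_def sum_2 algebra_simps)
    qed
  qed
  moreover have "card (rcosets\<^bsub>mixed_symbols_mod \<Gamma>\<^esub> (manin_image \<Gamma>)) \<noteq> 1"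
    if no: "\<not> ([p = 1] (mod 3) \<and> \<Gamma> = Gamma0 (p ^ n))"
  proof (rule manin_index_neq_1[OF \<Gamma> T L N])
    show "finite (pm_coset \<Gamma> ` carrier SL2Z)"
      using assms(1) by (intro finite_pm_cosets[OF \<Gamma> sub(1)]) (simp add: prime_gt_0_nat)
    fix g assume g: "g \<in> carrier SL2Z"
    show "pm_coset \<Gamma> (g ** matV) \<noteq> pm_coset \<Gamma> g"
    proof
      assume "pm_coset \<Gamma> (g ** matV) = pm_coset \<Gamma> g"
      then obtain \<gamma> where \<gamma>: "\<gamma> \<in> \<Gamma>" and "g ** matV = \<gamma> ** g \<or> g ** matV = - (\<gamma> ** g)"
        using pm_coset_eqD[OF \<Gamma>] by metis
      then have "\<gamma> ** g = g ** matV \<or> \<gamma> ** g = - (g ** matV)" by auto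
      note conj = conj_matV[OF g this]
      show False
      proof (cases "\<Gamma> = Gamma1 (p ^ n)")
        case True
        \<comment> \<open>Elements of \<open>Gamma1\<close> have trace 2 modulo p, whereas
          conjugates of V and -V have trace 1 or -1; the difference is -1 or -3.\<close>
        then have "[\<gamma>$1$1 + \<gamma>$2$2 = 1 + 1] (mod ?N)"
          using \<gamma> by (intro cong_add) (simp_all add: Gamma1_def)
        then have "int p dvd \<gamma>$1$1 + \<gamma>$2$2 - 2"
          using p_dvd by (auto simp: cong_iff_dvd_diff intro: dvd_trans)
        moreover have "\<gamma>$1$1 + \<gamma>$2$2 = 1 \<or> \<gamma>$1$1 + \<gamma>$2$2 = - 1" using conj(2) by linarith
        ultimately have "int p dvd 1 \<or> int p dvd 3" by auto
        then show False using assms(2) by (auto dest: zdvd_imp_le)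
      next
        case False
        then have "\<not> [p = 1] (mod 3)" using no assms(4) by simp
        moreover have "\<not> 3 dvd p" using assms(1,2) primes_dvd_imp_eq[of 3 p] by auto
        ultimately have p2: "[p = 2] (mod 3)" unfolding cong_def by presburger
        have "?N dvd \<gamma>$2$1" using \<gamma> sub(2) by (auto simp: Gamma0_def cong_0_iff)
        then have "int p dvd \<bar>\<gamma>$2$1\<bar>" using p_dvd by (simp add: dvd_trans)
        \<comment> \<open>For p = 2 modulo 3 the form vanishes modulo p only at (0, 0), but a bottom
          row in SL2(Z) is primitive.\<close>
        then have "int p dvd g$2$1 * g$2$1 + g$2$1 * g$2$2 + g$2$2 * g$2$2" unfolding conj by simp
        then have "int p dvd g$2$1 \<and> int p dvd g$2$2"
          using assms(2) by (intro prime_dvd_loeschian[OF assms(1) p2]) auto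
        then have "int p dvd g$1$1 * g$2$2 - g$1$2 * g$2$1" by (auto intro: dvd_diff dvd_mult)
        then have "int p dvd 1" using g by (simp add: SL2Z_iff)
        then show False using assms(2) by (auto dest: zdvd_imp_le)
      qed
    qed
  qed
  ultimately have "card (rcosets\<^bsub>mixed_symbols_mod \<Gamma>\<^esub> (manin_image \<Gamma>)) = 1
      \<longleftrightarrow> [p = 1] (mod 3) \<and> \<Gamma> = Gamma0 (p ^ n)" by blast
  moreover have "card (rcosets\<^bsub>mixed_symbols_mod \<Gamma>\<^esub> (manin_image \<Gamma>)) dvd 3"
    using index(2) by auto
  ultimately show ?thesis using index(1) by blast
qed

end
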